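(* Let $\pmb x=(x_1,\dots,x_k)$. (i) For a finitely generated congruence $E$ in one of $\mathbb{B}(\pmb x)$, $\mathbb{B}[\pmb x]$, $\mathbb{Z}_{\max}(\pmb x)$, $\mathbb{Z}_{\max}[\pmb x]$, $\mathbb{T}(\pmb x)$ or $\mathbb{T}[\pmb x]$, $\mathrm{Rad}(E)$ is the intersection of the prime congruences that contain $E$ and have a quotient of dimension at most $1$. (ii) In $\mathbb{T}[\pmb x]$, for any finitely generated congruence $E$, we have $E_+=\pmb E(V(E))$.
   Context: A semiring is a commutative semiring with additive identity $0$ and multiplicative identity $1$, with $1\neq 0$ and $a\cdot 0=0$ for all $a$; a $\mathbb{B}$-algebra is a semiring with idempotent addition. $\mathbb{B}=\{0,1\}$ is the two-element semifield with $1+1=1$. $\mathbb{T}$ is the tropical semifield on $\mathbb{R}\cup\{-\infty\}$ with maximum as addition and usual addition as multiplication; its elements are written $t^c$ ($c\in\mathbb{R}$) and $0$ (for $-\infty$), so $1=t^0$. $\mathbb{Z}_{\max}$ is the subsemifield of $\mathbb{T}$ consisting of $0$ and $t^c$, $c\in\mathbb{Z}$. For a semifield $F$, $F[\pmb x]$ (resp. $F(\pmb x)$) is the semiring of formal polynomials (resp. Laurent polynomials) in $x_1,\dots,x_k$ with coefficients in $F$. A congruence of $A$ is an equivalence relation $I\subseteq A\times A$ compatible with addition and multiplication; it is proper if $I\ne A\times A$; it is finitely generated if it is the smallest congruence containing some finite set of pairs. Pairs are added coordinatewise and the product (and powers) of pairs is always the twisted product $(\alpha_1,\alpha_2)(\beta_1,\beta_2)=(\alpha_1\beta_1+\alpha_2\beta_2,\alpha_1\beta_2+\alpha_2\beta_1)$,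 with $\alpha^0=(1,0)$. A congruence $P$ is prime if it is proper and $\alpha\beta\in P$ implies $\alpha\in P$ or $\beta\in P$ for all pairs $\alpha,\beta$. $\dim(A)$ is the length (number of strict inclusions) of the longest chain of prime congruences of $A$. $\mathrm{Rad}(I)$ is the intersection of all prime congruences containing $I$. An empty intersection of congruences of $A$ is $A\times A$. For a congruence $E$ of $\mathbb{T}[\pmb x]$, $V(E)=\{\pmb a\in\mathbb{T}^k\mid f(\pmb a)=g(\pmb a)\text{ for all }(f,g)\in E\}$. For $H\subseteq\mathbb{T}^k$, $\pmb E(H)=\{(f,g)\in\mathbb{T}[\pmb x]\times\mathbb{T}[\pmb x]\mid f(\pmb a)=g(\pmb a)\ \forall\pmb a\in H\}$. For a pair write $(f,g)^*=(f+g,0)$. $E_+$ is the set of all pairs $(f,g)$ in $\mathbb{T}[\pmb x]\times\mathbb{T}[\pmb x]$ for which there exist $\epsilon\in\mathbb{T}$ with $\epsilon\neq 1$, $h\in\mathbb{T}[\pmb x]$ and a non-negative integer $i$ such that $(1,\epsilon)\big(((f,g)^* )^i+(h,0)\big)(f,g)\in E$. *)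

theory Defs
  imports "HOL-Algebra.Ring" "HOL-Library.Poly_Mapping" "HOL-Library.Extended_Nat"
begin

section \<open>The tropical semifield and its subsemifields\<close>

text \<open>\<open>TPow c\<close> stands for $t^c$ and \<open>TZero\<close> for $-\infty$.\<close>

datatype tropical = TZero | TPow real

instantiation tropical :: comm_semiring_1
begin

definition "0 = TZero"

definition "1 = TPow 0"

fun plus_tropical :: "tropical \<Rightarrow> tropical \<Rightarrow> tropical" where
  "TZero + y = y"
| "x + TZero = x"
| "TPow a + TPow b = TPow (max a b)"

fun times_tropical :: "tropical \<Rightarrow> tropical \<Rightarrow> tropical" where
  "TZero * y = TZero"
| "x * TZero = TZero"
| "TPow a * TPow b = TPow (a + b)"

instance
proof
  fix a b c :: tropical
  show "a + b + c = a + (b + c)"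
    by (cases a; cases b; cases c) auto
  show "a + b = b + a"
    by (cases a; cases b) auto
  show "0 + a = a"
    by (simp add: zero_tropical_def)
  show "a * b * c = a * (b * c)"
    by (cases a; cases b; cases c) auto
  show "a * b = b * a"
    by (cases a; cases b) auto
  show "1 * a = a"
    by (cases a) (auto simp: one_tropical_def)
  show "(a + b) * c = a * c + b * c"
    by (cases a; cases b; cases c) (auto simp: max_def)
  show "0 * a = 0" "a * 0 = 0"
    by (cases a; simp add: zero_tropical_def)+
  show "(0::tropical) \<noteq> 1"
    by (simp add: zero_tropical_def one_tropical_def)
qed

end

text \<open>The two-element semifield is taken as the subsemifield $\{0, 1\}$ of the tropical one.\<close>

definition boolean_semifield :: "tropical set" where
  "boolean_semifield = {0, 1}"

definition zmax_semifield :: "tropical set" where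
  "zmax_semifield = insert 0 {TPow (of_int c) | c :: int. True}"

section \<open>Polynomials and Laurent polynomials\<close>

text \<open>
  The variables are indexed by a finite type \<open>'n\<close>; an exponent vector is an element of
  \<open>'n \<Rightarrow>\<^sub>0 nat\<close> (or \<open>'n \<Rightarrow>\<^sub>0 int\<close>), and the product of \<open>'e \<Rightarrow>\<^sub>0 tropical\<close> is convolution.
\<close>

definition formal_sums :: "tropical set \<Rightarrow> ('e::comm_monoid_add \<Rightarrow>\<^sub>0 tropical) ring" where
  "formal_sums F =
    \<lparr>carrier = {p. \<forall>m. Poly_Mapping.lookup p m \<in> F},
     mult = (*), one = 1, zero = 0, add = (+)\<rparr>"

definition polynomial_semiring :: "tropical set \<Rightarrow> (('n::finite \<Rightarrow>\<^sub>0 nat) \<Rightarrow>\<^sub>0 tropical) ring" where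
  "polynomial_semiring F = formal_sums F"

definition laurent_semiring :: "tropical set \<Rightarrow> (('n::finite \<Rightarrow>\<^sub>0 int) \<Rightarrow>\<^sub>0 tropical) ring" where
  "laurent_semiring F = formal_sums F"

definition poly_value :: "(('n::finite \<Rightarrow>\<^sub>0 nat) \<Rightarrow>\<^sub>0 tropical) \<Rightarrow> ('n \<Rightarrow> tropical) \<Rightarrow> tropical" where
  "poly_value p a =
    (\<Sum>m\<in>Poly_Mapping.keys p.
       Poly_Mapping.lookup p m * (\<Prod>i\<in>UNIV. a i ^ Poly_Mapping.lookup m i))"

section \<open>Pairs of semiring elements and congruences\<close>

text \<open>
  The record \<open>ring\<close> of HOL-Algebra is used only as a signature (it does not presuppose additive
  inverses).  All notions are relative to the carrier, so that they apply to quotients as well.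
\<close>

fun pair_add :: "('a, 'm) ring_scheme \<Rightarrow> 'a \<times> 'a \<Rightarrow> 'a \<times> 'a \<Rightarrow> 'a \<times> 'a" where
  "pair_add R (a, b) (c, d) = (a \<oplus>\<^bsub>R\<^esub> c, b \<oplus>\<^bsub>R\<^esub> d)"

fun twisted_prod :: "('a, 'm) ring_scheme \<Rightarrow> 'a \<times> 'a \<Rightarrow> 'a \<times> 'a \<Rightarrow> 'a \<times> 'a" where
  "twisted_prod R (a, b) (c, d) =
    ((a \<otimes>\<^bsub>R\<^esub> c) \<oplus>\<^bsub>R\<^esub> (b \<otimes>\<^bsub>R\<^esub> d), (a \<otimes>\<^bsub>R\<^esub> d) \<oplus>\<^bsub>R\<^esub> (b \<otimes>\<^bsub>R\<^esub> c))"

primrec twisted_power :: "('a, 'm) ring_scheme \<Rightarrow> 'a \<times> 'a \<Rightarrow> nat \<Rightarrow> 'a \<times> 'a" where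
  "twisted_power R \<alpha> 0 = (\<one>\<^bsub>R\<^esub>, \<zero>\<^bsub>R\<^esub>)"
| "twisted_power R \<alpha> (Suc n) = twisted_prod R \<alpha> (twisted_power R \<alpha> n)"

fun pair_star :: "('a, 'm) ring_scheme \<Rightarrow> 'a \<times> 'a \<Rightarrow> 'a \<times> 'a" where
  "pair_star R (f, g) = (f \<oplus>\<^bsub>R\<^esub> g, \<zero>\<^bsub>R\<^esub>)"

definition all_pairs :: "('a, 'm) ring_scheme \<Rightarrow> ('a \<times> 'a) set" where
  "all_pairs R = carrier R \<times> carrier R"

definition semiring_congruence :: "('a, 'm) ring_scheme \<Rightarrow> ('a \<times> 'a) set \<Rightarrow> bool" where
  "semiring_congruence R I \<longleftrightarrow>
    equiv (carrier R) I \<and>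
    (\<forall>a b c d. (a, b) \<in> I \<longrightarrow> (c, d) \<in> I \<longrightarrow>
       (a \<oplus>\<^bsub>R\<^esub> c, b \<oplus>\<^bsub>R\<^esub> d) \<in> I \<and> (a \<otimes>\<^bsub>R\<^esub> c, b \<otimes>\<^bsub>R\<^esub> d) \<in> I)"

definition fin_gen_congruence :: "('a, 'm) ring_scheme \<Rightarrow> ('a \<times> 'a) set \<Rightarrow> bool" where
  "fin_gen_congruence R I \<longleftrightarrow>
    semiring_congruence R I \<and>
    (\<exists>S. finite S \<and> S \<subseteq> I \<and> (\<forall>J. semiring_congruence R J \<and> S \<subseteq> J \<longrightarrow> I \<subseteq> J))"

definition prime_semiring_congruence :: "('a, 'm) ring_scheme \<Rightarrow> ('a \<times> 'a) set \<Rightarrow> bool" where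
  "prime_semiring_congruence R P \<longleftrightarrow>
    semiring_congruence R P \<and> P \<noteq> all_pairs R \<and>
    (\<forall>\<alpha>\<in>all_pairs R. \<forall>\<beta>\<in>all_pairs R. twisted_prod R \<alpha> \<beta> \<in> P \<longrightarrow> \<alpha> \<in> P \<or> \<beta> \<in> P)"

text \<open>The value is \<open>\<infinity>\<close> if there are arbitrarily long chains of prime congruences.\<close>

definition semiring_dim :: "('a, 'm) ring_scheme \<Rightarrow> enat" where
  "semiring_dim R =
    Sup {enat n | n. \<exists>P :: nat \<Rightarrow> ('a \<times> 'a) set.
           (\<forall>i\<le>n. prime_semiring_congruence R (P i)) \<and> (\<forall>i<n. P i \<subset> P (Suc i))}"

definition quotient_semiring :: "('a, 'm) ring_scheme \<Rightarrow> ('a \<times> 'a) set \<Rightarrow> 'a set ring" where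
  "quotient_semiring R I =
    \<lparr>carrier = carrier R // I,
     mult = (\<lambda>X Y. \<Union>x\<in>X. \<Union>y\<in>Y. I `` {x \<otimes>\<^bsub>R\<^esub> y}),
     one = I `` {\<one>\<^bsub>R\<^esub>},
     zero = I `` {\<zero>\<^bsub>R\<^esub>},
     add = (\<lambda>X Y. \<Union>x\<in>X. \<Union>y\<in>Y. I `` {x \<oplus>\<^bsub>R\<^esub> y})\<rparr>"

text \<open>An empty intersection of congruences is the improper congruence.\<close>

definition congruence_Inter :: "('a, 'm) ring_scheme \<Rightarrow> ('a \<times> 'a) set set \<Rightarrow> ('a \<times> 'a) set" where
  "congruence_Inter R \<C> = all_pairs R \<inter> \<Inter>\<C>"

definition congruence_radical :: "('a, 'm) ring_scheme \<Rightarrow> ('a \<times> 'a) set \<Rightarrow> ('a \<times> 'a) set" where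
  "congruence_radical R I = congruence_Inter R {P. prime_semiring_congruence R P \<and> I \<subseteq> P}"

section \<open>Congruences and point sets\<close>

type_synonym 'n trop_poly = "('n \<Rightarrow>\<^sub>0 nat) \<Rightarrow>\<^sub>0 tropical"

definition trop_variety :: "('n::finite trop_poly \<times> 'n trop_poly) set \<Rightarrow> ('n \<Rightarrow> tropical) set" where
  "trop_variety E = {a. \<forall>(f, g)\<in>E. poly_value f a = poly_value g a}"

definition vanishing_congruence ::
    "('n::finite \<Rightarrow> tropical) set \<Rightarrow> ('n trop_poly \<times> 'n trop_poly) set" where
  "vanishing_congruence H = {(f, g). \<forall>a\<in>H. poly_value f a = poly_value g a}"

text \<open>
  The constant polynomial with value \<open>\<epsilon>\<close> is \<open>Poly_Mapping.single 0 \<epsilon>\<close>.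
\<close>

definition E_plus ::
    "('n::finite trop_poly \<times> 'n trop_poly) set \<Rightarrow> ('n trop_poly \<times> 'n trop_poly) set" where
  "E_plus E =
    (let R = polynomial_semiring UNIV in
     {\<alpha>. \<exists>(\<epsilon>::tropical) (h::'n trop_poly) (i::nat). \<epsilon> \<noteq> 1 \<and>
        twisted_prod R
          (twisted_prod R (1, Poly_Mapping.single 0 \<epsilon>)
             (pair_add R (twisted_power R (pair_star R \<alpha>) i) (h, 0)))
          \<alpha> \<in> E})"

end

theory Submission
  imports Defs
begin

text \<open>
  Call \<open>x\<close> below \<open>y\<close> modulo a prime congruence \<open>P\<close> if \<open>(x + y, y) \<in> P\<close>: this is a total preorder, and
  the elements that are not congruent to \<open>0\<close> can be cancelled.  Only finitely many monomials occur in
  the generators of \<open>E\<close> and in a pair \<open>(f, g) \<notin> P\<close>.  Fourier-Motzkin elimination, which combines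
  constraints with integer multipliers and hence makes sense in the ordered monoid of monomials, gives
  real weights that order these monomials as \<open>P\<close> does.  The weights define a homomorphism to the
  tropical semifield whose kernel contains \<open>E\<close> but not \<open>(f, g)\<close>; the quotient by the kernel has
  dimension at most \<open>1\<close> because the reals are archimedean.  The homomorphism is the evaluation at a
  point, unless it is trivial on the constants, and then it identifies \<open>1\<close> with every nonzero \<open>\<epsilon>\<close>.
  So if \<open>(f, g)\<close> holds on \<open>V(E)\<close>, then \<open>\<beta> = (1, \<epsilon>)(f, g)\<close> lies in the radical of \<open>E\<close>.  Since a
  congruence that is maximal among those avoiding all \<open>((\<beta>\<^sup>*)\<^sup>i + (h, 0))\<beta>\<close> is prime, one of these
  pairs is in \<open>E\<close>; for \<open>\<epsilon> < 1\<close> we have \<open>\<beta>\<^sup>* = (f, g)\<^sup>*\<close>.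
\<close>

section \<open>Tropical arithmetic and evaluation of formal sums\<close>

text \<open>This is the canonical order of an idempotent semiring; with it addition becomes
  \<open>max\<close>, and 0, that is minus infinity, is the least element.\<close>

instantiation tropical :: linorder
begin

definition "x \<le> y \<longleftrightarrow> x + y = (y::tropical)"
definition "x < y \<longleftrightarrow> x \<le> y \<and> x \<noteq> (y::tropical)"

instance
proof
  fix x y z :: tropical
  show "x < y \<longleftrightarrow> x \<le> y \<and> \<not> y \<le> x"
    by (auto simp: less_eq_tropical_def less_tropical_def add.commute)
  show "x \<le> x"
    by (cases x) (auto simp: less_eq_tropical_def)
  show "x \<le> z" if "x \<le> y" "y \<le> z"
    using that by (metis less_eq_tropical_def add.assoc)
  show "x = y" if "x \<le> y" "y \<le> x"
    using that by (metis less_eq_tropical_def add.commute)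
  show "x \<le> y \<or> y \<le> x"
    by (cases x; cases y) (auto simp: less_eq_tropical_def)
qed

end

lemma tropical_add_eq_max: "x + y = max x (y::tropical)"
  by (metis add.commute less_eq_tropical_def linorder_linear max.absorb1 max.absorb2)

lemma TPow_le_iff [simp]: "TPow a \<le> TPow b \<longleftrightarrow> a \<le> b"
  by (auto simp: less_eq_tropical_def)

lemma TPow_less_iff [simp]: "TPow a < TPow b \<longleftrightarrow> a < b"
  by (auto simp: less_tropical_def)

lemma TPow_neq_0 [simp]: "TPow a \<noteq> 0"
  by (simp add: zero_tropical_def)

lemma tropical_zero_le [simp]: "0 \<le> (x::tropical)"
  by (simp add: less_eq_tropical_def)

lemma tropical_le_0_iff [simp]: "x \<le> 0 \<longleftrightarrow> x = (0::tropical)"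
  by (simp add: less_eq_tropical_def)

lemma tropical_add_eq_0_iff: "x + y = 0 \<longleftrightarrow> x = 0 \<and> y = (0::tropical)"
  by (cases x; cases y) (auto simp: zero_tropical_def)

lemma tropical_neq_0E: 
  assumes "x \<noteq> (0::tropical)"
  obtains a where "x = TPow a"
  using assms by (cases x) (auto simp: zero_tropical_def)

lemma tropical_no_zero_divisors [simp]: "x * y = 0 \<longleftrightarrow> x = 0 \<or> y = (0::tropical)"
  by (cases x; cases y) (auto simp: zero_tropical_def)

lemma tropical_mult_left_cancel: 
  assumes "c \<noteq> (0::tropical)"
  shows "c * a = c * b \<longleftrightarrow> a = b"
  using assms by (cases a; cases b; cases c) (auto simp: zero_tropical_def)

lemma TPow_power: "TPow a ^ n = TPow (real n * a)"
  by (induction n) (auto simp: one_tropical_def algebra_simps)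

lemma tropical_sum_le_iff: 
  "finite S \<Longrightarrow> (\<Sum>i\<in>S. f i) \<le> (b::tropical) \<longleftrightarrow> (\<forall>i\<in>S. f i \<le> b)"
  by (induction S rule: finite_induct) (auto simp: tropical_add_eq_max)

text \<open>A finite maximum is attained by a term. The hypothesis on \<open>a\<close> excludes the
  empty sum, which is 0 and has no term.\<close>

lemma tropical_le_sum_iff:
  "finite S \<Longrightarrow> (a::tropical) \<noteq> 0 \<Longrightarrow> a \<le> (\<Sum>i\<in>S. f i) \<longleftrightarrow> (\<exists>i\<in>S. a \<le> f i)"
  by (induction S rule: finite_induct) (auto simp: tropical_add_eq_max le_max_iff_disj)

text \<open>Scaling logarithms by \<open>l \<ge> 0\<close> is an endomorphism. The factor 1 keeps
  the constants and the factor 0 sends every nonzero constant to 1, so one formula serves primes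
  that keep the constants apart and primes that identify them.\<close>

fun trop_scale :: "real \<Rightarrow> tropical \<Rightarrow> tropical" where
  "trop_scale l TZero = TZero"
| "trop_scale l (TPow c) = TPow (l * c)"

lemma trop_scale_0 [simp]: "trop_scale l 0 = 0"
  by (simp add: zero_tropical_def)

lemma trop_scale_1 [simp]: "trop_scale l 1 = 1"
  by (simp add: one_tropical_def)

lemma trop_scale_mult: "trop_scale l (x * y) = trop_scale l x * trop_scale l y"
  by (cases x; cases y) (auto simp: algebra_simps)

lemma trop_scale_add: "0 \<le> l \<Longrightarrow> trop_scale l (x + y) = trop_scale l x + trop_scale l y"
  by (cases x; cases y) (auto simp: max_mult_distrib_left)

lemma trop_scale_by_1 [simp]: "trop_scale 1 x = x"
  by (cases x) auto

section \<open>Formal sums as sums of single terms, and their evaluation\<close>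

lemma poly_mapping_add_idem: "x + x = (x :: 'e \<Rightarrow>\<^sub>0 tropical)"
  by (rule poly_mapping_eqI) (simp add: lookup_add tropical_add_eq_max)

lemma sum_single_lookup:
  "(\<Sum>m\<in>Poly_Mapping.keys p. Poly_Mapping.single m (Poly_Mapping.lookup p m)) = p"
  by (rule poly_mapping_eqI)
    (auto simp: lookup_sum lookup_single when_def in_keys_iff)

lemma mult_eq_sum_single:
  fixes p q :: "'e::comm_monoid_add \<Rightarrow>\<^sub>0 'b::comm_semiring_1"
  shows "p * q = (\<Sum>m\<in>Poly_Mapping.keys p. \<Sum>n\<in>Poly_Mapping.keys q.
       Poly_Mapping.single (m + n) (Poly_Mapping.lookup p m * Poly_Mapping.lookup q n))"
proof -
  have "p * q = (\<Sum>m\<in>Poly_Mapping.keys p. Poly_Mapping.single m (Poly_Mapping.lookup p m)) 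
      * (\<Sum>n\<in>Poly_Mapping.keys q. Poly_Mapping.single n (Poly_Mapping.lookup q n))"
    by (simp add: sum_single_lookup)
  then show ?thesis
    by (simp add: sum_product mult_single)
qed

definition eval_sum ::
  "('b \<Rightarrow> 'c) \<Rightarrow> ('e \<Rightarrow> 'c) \<Rightarrow> ('e \<Rightarrow>\<^sub>0 'b::zero) \<Rightarrow> 'c::comm_semiring_1" where
  "eval_sum \<kappa> \<chi> p = (\<Sum>m\<in>Poly_Mapping.keys p. \<kappa> (Poly_Mapping.lookup p m) * \<chi> m)"

text \<open>A homomorphism of coefficients and a character of the exponent monoid extend to formal
  sums, as in the universal property of a monoid semiring. Evaluation at points and the maps given
  by real weights both have this form.\<close>

locale monoid_eval =
  fixes \<kappa> :: "'b::comm_semiring_1 \<Rightarrow> 'c::comm_semiring_1" and \<chi> :: "'e::comm_monoid_add \<Rightarrow> 'c"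
  assumes \<kappa>_0: "\<kappa> 0 = 0" and \<kappa>_1: "\<kappa> 1 = 1" 
    and \<kappa>_add: "\<kappa> (a + b) = \<kappa> a + \<kappa> b" and \<kappa>_mult: "\<kappa> (a * b) = \<kappa> a * \<kappa> b"
    and \<chi>_0: "\<chi> 0 = 1" and \<chi>_add: "\<chi> (m + m') = \<chi> m * \<chi> m'"
begin

abbreviation "ev \<equiv> eval_sum \<kappa> \<chi>"

text \<open>Terms outside the support contribute 0; this brings the sums for \<open>p\<close>,
  \<open>q\<close> and \<open>p + q\<close> to a common index set.\<close>

lemma ev_superset:
  assumes "finite K" "Poly_Mapping.keys p \<subseteq> K"
  shows "ev p = (\<Sum>m\<in>K. \<kappa> (Poly_Mapping.lookup p m) * \<chi> m)"
  unfolding eval_sum_def using assms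
  by (intro sum.mono_neutral_left) (auto simp: in_keys_iff \<kappa>_0)

lemma ev_zero: "ev 0 = 0"
  by (simp add: eval_sum_def)

lemma ev_single: "ev (Poly_Mapping.single m c) = \<kappa> c * \<chi> m"
  by (subst ev_superset[of "{m}"]) auto

lemma ev_one: "ev 1 = 1"
  using ev_single[of 0 1] by (simp add: \<kappa>_1 \<chi>_0)

lemma ev_add: "ev (p + q) = ev p + ev q"
proof -
  let ?K = "Poly_Mapping.keys p \<union> Poly_Mapping.keys q"
  have "ev (p + q) = (\<Sum>m\<in>?K. \<kappa> (Poly_Mapping.lookup (p + q) m) * \<chi> m)"
    by (rule ev_superset) (simp_all add: keys_add)
  also have "\<dots> = (\<Sum>m\<in>?K. \<kappa> (Poly_Mapping.lookup p m) * \<chi> m) 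
      + (\<Sum>m\<in>?K. \<kappa> (Poly_Mapping.lookup q m) * \<chi> m)"
    by (simp add: lookup_add \<kappa>_add algebra_simps sum.distrib)
  also have "\<dots> = ev p + ev q"
    by (subst (1 2) ev_superset[of ?K]) auto
  finally show ?thesis .
qed

lemma ev_sum: "ev (\<Sum>i\<in>K. f i) = (\<Sum>i\<in>K. ev (f i))"
  by (induction K rule: infinite_finite_induct) (auto simp: ev_zero ev_add)

lemma ev_mult: "ev (p * q) = ev p * ev q"
proof -
  let ?l = Poly_Mapping.lookup
  have "ev (p * q) = (\<Sum>m\<in>Poly_Mapping.keys p. \<Sum>n\<in>Poly_Mapping.keys q.
       (\<kappa> (?l p m) * \<chi> m) * (\<kappa> (?l q n) * \<chi> n))"
    by (simp add: mult_eq_sum_single ev_sum ev_single \<kappa>_mult \<chi>_add ac_simps)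
  then show ?thesis
    by (simp add: eval_sum_def sum_product)
qed

end

section \<open>Evaluation of polynomials at points\<close>

definition monomial_value :: "('n::finite \<Rightarrow> tropical) \<Rightarrow> ('n \<Rightarrow>\<^sub>0 nat) \<Rightarrow> tropical" where
  "monomial_value a m = (\<Prod>i\<in>UNIV. a i ^ Poly_Mapping.lookup m i)"

lemma poly_value_eq_eval_sum: "poly_value p a = eval_sum id (monomial_value a) p"
  by (simp add: poly_value_def eval_sum_def monomial_value_def)

interpretation poly_value: monoid_eval id "monomial_value a"
  by standard (simp_all add: monomial_value_def lookup_add power_add prod.distrib)

text \<open>An exponent vector is a sum of multiples of unit vectors, so a character is fixed by its
  values on the variables. Natural exponents allow the value 0 there, hence every tropical character
  comes from a point.\<close>

lemma multiplicative_eq_monomial_value: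
  fixes \<chi> :: "('n::finite \<Rightarrow>\<^sub>0 nat) \<Rightarrow> tropical"
  assumes "\<chi> 0 = 1" and add: "\<And>m m'. \<chi> (m + m') = \<chi> m * \<chi> m'"
  shows "\<chi> = monomial_value (\<lambda>i. \<chi> (Poly_Mapping.single i 1))"
proof
  fix m :: "'n \<Rightarrow>\<^sub>0 nat"
  have sum: "\<chi> (\<Sum>i\<in>K. f i) = (\<Prod>i\<in>K. \<chi> (f i))" for K :: "'n set" and f
    by (induction K rule: infinite_finite_induct) (auto simp: assms)
  have pow: "\<chi> (Poly_Mapping.single i n) = \<chi> (Poly_Mapping.single i 1) ^ n" for i n
  proof (induction n)
    case (Suc n)
    have "Poly_Mapping.single i (Suc n) = Poly_Mapping.single i 1 + Poly_Mapping.single i n"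
      by (simp flip: single_add)
    with Suc show ?case
      by (simp add: add)
  qed (simp add: assms)
  have "m = (\<Sum>i\<in>UNIV. Poly_Mapping.single i (Poly_Mapping.lookup m i))"
    by (rule poly_mapping_eqI) (simp add: lookup_sum lookup_single when_def)
  then have "\<chi> m = (\<Prod>i\<in>UNIV. \<chi> (Poly_Mapping.single i (Poly_Mapping.lookup m i)))"
    using sum by metis
  then show "\<chi> m = monomial_value (\<lambda>i. \<chi> (Poly_Mapping.single i 1)) m"
    by (simp add: monomial_value_def pow[of _ "Poly_Mapping.lookup m _"])
qed

section \<open>Fourier-Motzkin elimination\<close>

text \<open>The flag \<open>s\<close> marks a strict inequality, so weak and strict constraints pass
  through the elimination together.\<close>

definition positive_upto :: "bool \<Rightarrow> real \<Rightarrow> bool" where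
  "positive_upto s x \<longleftrightarrow> 0 \<le> x \<and> (s \<longrightarrow> x \<noteq> 0)"

lemma positive_upto_mult: "0 < k \<Longrightarrow> positive_upto s (k * x) \<longleftrightarrow> positive_upto s x"
  by (auto simp: positive_upto_def zero_le_mult_iff)

text \<open>There is room between the largest of the lower bounds and the smallest of the upper
  bounds. If the two coincide, the hypothesis \<open>LU\<close> leaves no strict bound at that
  place.\<close>

lemma strict_between_finite:
  assumes fin: "finite L" "finite U"
    and LU: "\<And>s l s' u. (s, l) \<in> L \<Longrightarrow> (s', u) \<in> U \<Longrightarrow> positive_upto (s \<or> s') (u - l)"
  obtains x where "\<And>s l. (s, l) \<in> L \<Longrightarrow> positive_upto s (x - l)"
    "\<And>s u. (s, u) \<in> U \<Longrightarrow> positive_upto s (u - x)"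
proof -
  define lo where "lo = Max (snd ` L)"
  define hi where "hi = Min (snd ` U)"
  have lo: "l \<le> lo" if "(s, l) \<in> L" for s l
    unfolding lo_def using that fin by (intro Max_ge) force+
  have hi: "hi \<le> u" if "(s, u) \<in> U" for s u
    unfolding hi_def using that fin by (intro Min_le) force+
  consider "L = {}" | "U = {}" | "L \<noteq> {}" "U \<noteq> {}" by blast
  then show thesis
  proof cases
    case 1
    show thesis
      by (rule that[of "hi - 1"]) (use 1 hi in \<open>force simp: positive_upto_def\<close>)+
  next
    case 2
    show thesis
      by (rule that[of "lo + 1"]) (use 2 lo in \<open>force simp: positive_upto_def\<close>)+
  next
    case 3
    obtain s0 where s0: "(s0, lo) \<in> L"
      using Max_in[of "snd ` L"] 3 fin unfolding lo_def by fastforce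
    obtain s1 where s1: "(s1, hi) \<in> U"
      using Min_in[of "snd ` U"] 3 fin unfolding hi_def by fastforce
    have "lo \<le> hi"
      using LU[OF s0 s1] by (simp add: positive_upto_def)
    show thesis
    \<comment> \<open>The midpoint can equal a bound only if \<open>lo = hi\<close>, and then
      \<open>LU\<close> against the opposite extreme shows that this bound is weak.\<close>
    proof (rule that[of "(lo + hi) / 2"])
      fix s l assume l: "(s, l) \<in> L"
      show "positive_upto s ((lo + hi) / 2 - l)"
        using lo[OF l] LU[OF l s1] \<open>lo \<le> hi\<close> by (auto simp: positive_upto_def field_simps)
    next
      fix s u assume u: "(s, u) \<in> U"
      show "positive_upto s (u - (lo + hi) / 2)"
        using hi[OF u] LU[OF s0 u] \<open>lo \<le> hi\<close> by (auto simp: positive_upto_def field_simps)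
    qed
  qed
qed

text \<open>A triple \<open>(s, c, m)\<close> stands for the constraint that \<open>c\<close> plus
  the product of the weights with \<open>m\<close> is nonnegative, and nonzero if \<open>s\<close>
  is true. Eliminating a variable uses only sums and positive integer multiples of constraints, so
  it never leaves \<open>G\<close>; when no variable remains, \<open>const\<close> says that the
  constants satisfy their constraints.\<close>

lemma fourier_motzkin:
  fixes G :: "(bool \<times> real \<times> ('n::finite \<Rightarrow> int)) set"
  assumes add: "\<And>s c m s' c' m'. (s, c, m) \<in> G \<Longrightarrow> (s', c', m') \<in> G \<Longrightarrow>
      (s \<or> s', c + c', \<lambda>i. m i + m' i) \<in> G"
    and const: "\<And>s c. (s, c, \<lambda>_. 0) \<in> G \<Longrightarrow> positive_upto s c"
    and D: "finite D" "D \<subseteq> G"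
  obtains w :: "'n \<Rightarrow> real" where
    "\<And>s c m. (s, c, m) \<in> D \<Longrightarrow> positive_upto s (c + (\<Sum>i\<in>UNIV. w i * of_int (m i)))"
proof -
  have mult_Suc: "(s, real (Suc n) * c, \<lambda>i. int (Suc n) * m i) \<in> G" 
    if "(s, c, m) \<in> G" for s c m n
  proof (induction n)
    case (Suc n)
    from add[OF that Suc] show ?case
      by (simp add: algebra_simps)
  qed (use that in simp)
  have mult: "(s, of_int k * c, \<lambda>i. k * m i) \<in> G" if "(s, c, m) \<in> G" "k > 0" for s c m k
    using mult_Suc[OF that(1), of "nat k - 1"] that(2) by (simp add: Suc_nat_eq_nat_zadd1)
  \<comment> \<open>\<open>V\<close> holds the variables that may still occur in \<open>D\<close>;
    the system \<open>D\<close> is generalized because each elimination replaces it.\<close>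
  have "\<exists>w :: 'n \<Rightarrow> real. \<forall>(s, c, m)\<in>D. positive_upto s (c + (\<Sum>i\<in>V. w i * of_int (m i)))"
    if "finite V" "finite D" "D \<subseteq> G" "\<forall>(s, c, m)\<in>D. \<forall>i. i \<notin> V \<longrightarrow> m i = 0" 
    for V :: "'n set" and D
    using that
  proof (induction V arbitrary: D rule: finite_induct)
    case empty
    have "positive_upto s c" if "(s, c, m) \<in> D" for s c m
    proof -
      have "m = (\<lambda>_. 0)"
        using that empty by blast
      then show ?thesis
        using const that empty by blast
    qed
    then show ?case by auto
  next
    case (insert j V)
    define Dp where "Dp = {d \<in> D. snd (snd d) j > 0}"
    define Dn where "Dn = {d \<in> D. snd (snd d) j < 0}"
    \<comment> \<open>The positive multipliers \<open>- m' j\<close> and \<open>m j\<close> make the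
      coordinate \<open>j\<close> cancel; one strict partner makes the combination strict.\<close>
    define comb :: "(bool \<times> real \<times> ('n \<Rightarrow> int)) \<times> (bool \<times> real \<times> ('n \<Rightarrow> int)) \<Rightarrow> _" where
      "comb = (\<lambda>((s, c, m), (s', c', m')).
        (s \<or> s', of_int (- m' j) * c + of_int (m j) * c', \<lambda>i. - m' j * m i + m j * m' i))"
    define D' where "D' = {d \<in> D. snd (snd d) j = 0} \<union> comb ` (Dp \<times> Dn)"
    have fin: "finite Dp" "finite Dn" "finite D'"
      using insert.prems by (auto simp: Dp_def Dn_def D'_def)
    have "comb (d, d') \<in> G" if d: "d \<in> Dp" "d' \<in> Dn" for d d'
    proof -
      obtain s c m s' c' m' where eq: "d = (s, c, m)" "d' = (s', c', m')"
        by (metis prod_cases3)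
      with d insert.prems have "(s, c, m) \<in> G" "m j > 0" "(s', c', m') \<in> G" "- m' j > 0"
        by (auto simp: Dp_def Dn_def)
      with add[OF mult[of s c m "- m' j"] mult[of s' c' m' "m j"]] show ?thesis
        unfolding eq comb_def by simp
    qed
    then have D'G: "D' \<subseteq> G"
      using insert.prems by (auto simp: D'_def)
    have "\<forall>(s, c, m)\<in>D'. \<forall>i. i \<notin> V \<longrightarrow> m i = 0"
    proof (clarify)
      fix s c m i assume smd: "(s, c, m) \<in> D'" and iV: "i \<notin> V"
      from smd consider "(s, c, m) \<in> D" "m j = 0" 
        | s1 c1 m1 s2 c2 m2 where "(s1, c1, m1) \<in> D" "(s2, c2, m2) \<in> D" 
          "m = (\<lambda>i. - m2 j * m1 i + m1 j * m2 i)"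
        unfolding D'_def Dp_def Dn_def comb_def by fastforce
      then show "m i = 0"
      proof cases
        case 1
        then show ?thesis using insert.prems(3) iV by (cases "i = j") auto
      next
        case 2
        then have "i \<noteq> j \<Longrightarrow> m1 i = 0 \<and> m2 i = 0" 
          using insert.prems(3) iV by fastforce
        with 2 show ?thesis
          by (cases "i = j") auto
      qed
    qed
    from insert.IH[OF fin(3) D'G this] obtain w where
      w: "\<And>s c m. (s, c, m) \<in> D' \<Longrightarrow> positive_upto s (c + (\<Sum>i\<in>V. w i * of_int (m i)))"
      by blast
    define val where "val = (\<lambda>(s::bool, c, m::'n \<Rightarrow> int). c + (\<Sum>i\<in>V. w i * of_int (m i)))"
    \<comment> \<open>Solved for the new weight, a constraint with positive coefficient at
      \<open>j\<close> is a lower bound, and one with negative coefficient is an upper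
      bound.\<close>
    define L where "L = (\<lambda>d. (fst d, - val d / snd (snd d) j)) ` Dp"
    define U where "U = (\<lambda>d. (fst d, - val d / snd (snd d) j)) ` Dn"
    have "finite L" "finite U"
      using fin by (auto simp: L_def U_def)
    moreover have "positive_upto (s \<or> s') (u - l)" if "(s, l) \<in> L" "(s', u) \<in> U" for s l s' u
    proof -
      from that obtain c m c' m' where d: "(s, c, m) \<in> Dp" "(s', c', m') \<in> Dn" 
        and l: "l = - val (s, c, m) / m j" and u: "u = - val (s', c', m') / m' j"
        by (auto simp: L_def U_def)
      have sg: "m j > 0" "m' j < 0"
        using d by (auto simp: Dp_def Dn_def)
      have "comb ((s, c, m), (s', c', m')) \<in> D'"
        using d by (auto simp: D'_def)
      then have "positive_upto (s \<or> s') ((of_int (- m' j) * c + of_int (m j) * c') 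
          + (\<Sum>i\<in>V. w i * of_int (- m' j * m i + m j * m' i)))"
        unfolding comb_def by (auto dest!: w)
      also have "(of_int (- m' j) * c + of_int (m j) * c') 
          + (\<Sum>i\<in>V. w i * of_int (- m' j * m i + m j * m' i)) 
          = of_int (- m' j) * val (s, c, m) + of_int (m j) * val (s', c', m')"
        by (simp add: val_def sum_distrib_left sum_subtractf sum_negf algebra_simps)
      \<comment> \<open>Up to a positive factor the combined constraint compares the upper bound
        with the lower one, with the required strictness.\<close>
      also have "\<dots> = of_int (m j * - m' j) * (u - l)"
        using sg by (simp add: l u field_simps)
      finally show ?thesis
        using sg by (subst (asm) positive_upto_mult) (auto simp: mult_pos_neg simp flip: of_int_mult)
    qed
    ultimately obtain x where xL: "\<And>s l. (s, l) \<in> L \<Longrightarrow> positive_upto s (x - l)"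
      and xU: "\<And>s u. (s, u) \<in> U \<Longrightarrow> positive_upto s (u - x)"
      using strict_between_finite by metis
    define w' where "w' = w(j := x)"
    have w': "c + (\<Sum>i\<in>insert j V. w' i * of_int (m i)) = val (s, c, m) + x * m j" for s c m
    proof -
      have "(\<Sum>i\<in>V. w' i * of_int (m i)) = (\<Sum>i\<in>V. w i * of_int (m i))"
        using insert.hyps by (intro sum.cong) (auto simp: w'_def)
      then show ?thesis
        using insert.hyps by (simp add: val_def w'_def)
    qed
    have "positive_upto s (c + (\<Sum>i\<in>insert j V. w' i * of_int (m i)))" if d: "(s, c, m) \<in> D" for s c m
    proof -
      consider "m j = 0" | "m j > 0" | "m j < 0" by linarith
      then show ?thesis
      proof cases
        case 1
        then have "(s, c, m) \<in> D'"
          using d by (simp add: D'_def)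
        from w[OF this] 1 show ?thesis
          unfolding w'[of c m s] by (simp add: val_def)
      next
        case 2
        then have "(s, - val (s, c, m) / m j) \<in> L"
          using d by (force simp: L_def Dp_def)
        from xL[OF this] have "positive_upto s (of_int (m j) * (x + val (s, c, m) / m j))"
          using 2 by (subst positive_upto_mult) auto
        also have "of_int (m j) * (x + val (s, c, m) / m j) = val (s, c, m) + x * m j"
          using 2 by (simp add: field_simps)
        finally show ?thesis
          unfolding w'[of c m s] .
      next
        case 3
        then have "(s, - val (s, c, m) / m j) \<in> U"
          using d by (force simp: U_def Dn_def)
        from xU[OF this] have "positive_upto s (of_int (- m j) * (- val (s, c, m) / m j - x))"
          using 3 by (subst positive_upto_mult) auto
        also have "of_int (- m j) * (- val (s, c, m) / m j - x) = val (s, c, m) + x * m j"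
          using 3 by (simp add: field_simps)
        finally show ?thesis
          unfolding w'[of c m s] .
      qed
    qed
    then show ?case by blast
  qed
  from this[of UNIV D] D have "\<exists>w :: 'n \<Rightarrow> real. \<forall>(s, c, m)\<in>D.
      positive_upto s (c + (\<Sum>i\<in>UNIV. w i * of_int (m i)))" by simp
  with that show thesis by blast
qed

section \<open>Prime congruences of idempotent semirings\<close>

text \<open>The operations are those of the type class, which supplies the semiring laws, so that
  only closure of the carrier is left to assume.\<close>

definition subsemiring :: "'a::comm_semiring_1 set \<Rightarrow> 'a ring" where
  "subsemiring A = \<lparr>carrier = A, mult = (*), one = 1, zero = 0, add = (+)\<rparr>"

lemma subsemiring_simps [simp]:
  "carrier (subsemiring A) = A" "x \<otimes>\<^bsub>subsemiring A\<^esub> y = x * y" "x \<oplus>\<^bsub>subsemiring A\<^esub> y = x + y"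
  "\<one>\<^bsub>subsemiring A\<^esub> = 1" "\<zero>\<^bsub>subsemiring A\<^esub> = 0"
  by (simp_all add: subsemiring_def)

section \<open>Congruences on an idempotent semiring and the preorders that they induce\<close>

locale idem_subsemiring =
  fixes A :: "'a::comm_semiring_1 set"
  assumes zero_mem [simp]: "0 \<in> A" and one_mem [simp]: "1 \<in> A"
    and add_mem [simp]: "x \<in> A \<Longrightarrow> y \<in> A \<Longrightarrow> x + y \<in> A"
    and mult_mem [simp]: "x \<in> A \<Longrightarrow> y \<in> A \<Longrightarrow> x * y \<in> A"
    and idem: "x \<in> A \<Longrightarrow> x + x = x"
begin

lemma power_mem [simp]: "x \<in> A \<Longrightarrow> x ^ n \<in> A"
  by (induction n) auto

lemma sum_mem: 
  assumes "\<And>i. i \<in> K \<Longrightarrow> f i \<in> A"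
  shows "(\<Sum>i\<in>K. f i) \<in> A"
  using assms by (induction K rule: infinite_finite_induct) auto

lemma add_idem_left [simp]: "x \<in> A \<Longrightarrow> x + (x + y) = x + y"
  by (simp add: idem flip: add.assoc)

end

locale cong = idem_subsemiring A for A :: "'a::comm_semiring_1 set" +
  fixes P :: "('a \<times> 'a) set"
  assumes refl: "x \<in> A \<Longrightarrow> (x, x) \<in> P"
    and sym: "(x, y) \<in> P \<Longrightarrow> (y, x) \<in> P"
    and trans: "(x, y) \<in> P \<Longrightarrow> (y, z) \<in> P \<Longrightarrow> (x, z) \<in> P"
    and add: "(x, y) \<in> P \<Longrightarrow> (x', y') \<in> P \<Longrightarrow> (x + x', y + y') \<in> P"
    and mult: "(x, y) \<in> P \<Longrightarrow> (x', y') \<in> P \<Longrightarrow> (x * x', y * y') \<in> P"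
begin

text \<open>The canonical order of the quotient by \<open>P\<close>, pulled back to representatives;
  it turns statements about classes into inequalities.\<close>

definition le :: "'a \<Rightarrow> 'a \<Rightarrow> bool" where
  "le x y \<longleftrightarrow> (x + y, y) \<in> P"

lemma equiv:
  assumes "P \<subseteq> A \<times> A"
  shows "equiv A P"
proof (rule equivI)
  show "refl_on A P"
    using assms by (auto simp: refl_on_def intro: refl)
  show "sym P"
    by (rule symI) (rule sym)
  show "trans P"
    by (rule transI) (rule trans)
qed (rule assms)

lemma congI:
  assumes "P \<subseteq> A \<times> A"
  shows "semiring_congruence (subsemiring A) P"
  using equiv[OF assms] by (auto simp: semiring_congruence_def intro: add mult)

lemma power: "(x, y) \<in> P \<Longrightarrow> (x ^ n, y ^ n) \<in> P"
  by (induction n) (auto intro: mult refl)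

lemma le_refl: "x \<in> A \<Longrightarrow> le x x"
  by (simp add: le_def idem refl)

lemma le_trans:
  assumes "x \<in> A" "z \<in> A" "le x y" "le y z"
  shows "le x z"
proof -
  have "(x + z, x + (y + z)) \<in> P" "(x + y + z, y + z) \<in> P" "(y + z, z) \<in> P"
    using assms by (auto simp: le_def intro!: add refl intro: sym)
  then show ?thesis
    unfolding le_def using trans by (metis add.assoc)
qed

lemma le_antisym: "le x y \<Longrightarrow> le y x \<Longrightarrow> (x, y) \<in> P"
  unfolding le_def by (metis add.commute sym trans)

lemma le_cong:
  assumes "x \<in> A" "y \<in> A" "(x, y) \<in> P"
  shows "le x y"
  using add[OF assms(3) refl[OF assms(2)]] assms by (simp add: le_def idem)

lemma le_mult_left: 
  assumes "c \<in> A" "le x y"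
  shows "le (c * x) (c * y)"
  using mult[OF refl[OF assms(1)], of "x + y" y] assms by (simp add: le_def algebra_simps)

lemma le_add_iff:
  assumes "x \<in> A" "y \<in> A" "z \<in> A"
  shows "le (x + y) z \<longleftrightarrow> le x z \<and> le y z"
proof
  assume *: "le (x + y) z"
  have "le x (x + y)" "le y (x + y)"
    using assms by (auto simp: le_def add.left_commute idem intro!: refl)
  with * assms show "le x z \<and> le y z"
    using le_trans by (meson add_mem)
next
  assume "le x z \<and> le y z"
  then have "(x + (y + z), x + z) \<in> P" "(x + z, z) \<in> P"
    using assms by (auto simp: le_def intro!: add refl)
  then show "le (x + y) z"
    unfolding le_def using trans by (metis add.assoc)
qed

lemma le_zero_iff: "le x 0 \<longleftrightarrow> (x, 0) \<in> P"
  by (simp add: le_def)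

lemma zero_le: "x \<in> A \<Longrightarrow> le 0 x"
  by (simp add: le_def refl)

lemma le_mult_mono:
  assumes "x \<in> A" "y \<in> A" "x' \<in> A" "y' \<in> A" "le x y" "le x' y'"
  shows "le (x * x') (y * y')"
  using le_trans[of "x * x'" "y * y'" "x * y'"] le_mult_left[of x x' y'] le_mult_left[of y' x y] assms
  by (simp add: mult.commute)

lemma le_power_mono: "x \<in> A \<Longrightarrow> y \<in> A \<Longrightarrow> le x y \<Longrightarrow> le (x ^ n) (y ^ n)"
  by (induction n) (auto intro: le_mult_mono le_refl)

lemma le_sum_iff:
  assumes "finite K" "\<And>i. i \<in> K \<Longrightarrow> f i \<in> A" "y \<in> A"
  shows "le (\<Sum>i\<in>K. f i) y \<longleftrightarrow> (\<forall>i\<in>K. le (f i) y)"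
  using assms by (induction K rule: finite_induct) (auto simp: zero_le le_add_iff sum_mem)

lemma zero_mult: "(x, 0) \<in> P \<Longrightarrow> c \<in> A \<Longrightarrow> (c * x, 0) \<in> P"
  using mult[OF refl, of c x 0] by simp

end

text \<open>Primeness is divided into cancellation and, in \<open>prime_cong\<close>, totality,
  because the congruence constructed later by maximality is first shown to be cancellative and this
  is used to prove it total.\<close>

locale cancellative_cong = cong +
  assumes proper: "(1, 0) \<notin> P"
    and cancel: "a \<in> A \<Longrightarrow> b \<in> A \<Longrightarrow> c \<in> A \<Longrightarrow> (c * a, c * b) \<in> P \<Longrightarrow> (c, 0) \<in> P \<or> (a, b) \<in> P"
begin

lemma mult_zero_iff:
  assumes "a \<in> A" "b \<in> A"
  shows "(a * b, 0) \<in> P \<longleftrightarrow> (a, 0) \<in> P \<or> (b, 0) \<in> P"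
  using cancel[of b 0 a] zero_mult[of a b] zero_mult[of b a] assms by (auto simp: mult.commute)

lemma power_zero_iff:
  assumes "a \<in> A"
  shows "(a ^ n, 0) \<in> P \<longleftrightarrow> n > 0 \<and> (a, 0) \<in> P"
  using assms by (induction n) (auto simp: mult_zero_iff proper)

lemma le_mult_cancel:
  assumes "c \<in> A" "x \<in> A" "y \<in> A" "(c, 0) \<notin> P"
  shows "le (c * x) (c * y) \<longleftrightarrow> le x y"
  using assms cancel[of "x + y" y c] le_mult_left[of c x y] 
  by (auto simp: le_def algebra_simps)

text \<open>In the chain \<open>x * x' \<le> y * x' \<le> y * y'\<close> equality of the ends gives
  equality of the first two terms, where \<open>x'\<close> can be cancelled. Hence a product of
  inequalities is strict if one factor is strict and the left side of the other is not congruent to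
  0.\<close>

lemma mult_strict:
  assumes "x \<in> A" "y \<in> A" "x' \<in> A" "y' \<in> A" "le x y" "le x' y'" 
    and nz: "(x', 0) \<notin> P" and eq: "(x * x', y * y') \<in> P"
  shows "(x, y) \<in> P"
proof -
  have "le (y * x') (y * y')" "le (y * y') (x * x')"
    using assms by (auto intro: le_mult_left le_cong sym)
  then have "le (x' * y) (x' * x)"
    using le_trans[of "y * x'" "x * x'" "y * y'"] assms by (simp add: mult.commute)
  then show ?thesis
    using assms by (auto simp: le_mult_cancel intro: le_antisym)
qed

end

section \<open>Prime congruences: cancellation and a total preorder\<close>

locale prime_cong = cancellative_cong +
  assumes total: "a \<in> A \<Longrightarrow> b \<in> A \<Longrightarrow> (a + b, a) \<in> P \<or> (a + b, b) \<in> P"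
begin

lemma le_total: "x \<in> A \<Longrightarrow> y \<in> A \<Longrightarrow> le x y \<or> le y x"
  using total[of x y] by (auto simp: le_def add.commute)

lemma le_add_right_iff:
  assumes "x \<in> A" "y \<in> A" "z \<in> A"
  shows "le x (y + z) \<longleftrightarrow> le x y \<or> le x z"
proof
  assume *: "le x (y + z)"
  show "le x y \<or> le x z"
    using total[of y z] le_trans[OF _ _ *, of y] le_trans[OF _ _ *, of z] 
      le_cong[of "y + z" y] le_cong[of "y + z" z] assms by auto
next
  have "le y (y + z)" "le z (y + z)"
    using assms by (auto simp: le_def add.left_commute idem intro!: refl)
  then show "le x y \<or> le x z \<Longrightarrow> le x (y + z)"
    using le_trans assms by (meson add_mem)
qed

lemma le_sum_right_iff:
  assumes "finite K" "\<And>i. i \<in> K \<Longrightarrow> f i \<in> A" "x \<in> A" "(x, 0) \<notin> P"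
  shows "le x (\<Sum>i\<in>K. f i) \<longleftrightarrow> (\<exists>i\<in>K. le x (f i))"
  using assms by (induction K rule: finite_induct) (auto simp: le_zero_iff le_add_right_iff sum_mem)

text \<open>Let \<open>a\<close> and \<open>c\<close> be the larger entries. Then
  \<open>a * c\<close> is below \<open>a * d + b * c\<close>, hence below one of the summands by
  totality, and cancelling \<open>a\<close> or \<open>c\<close> puts \<open>c\<close> below
  \<open>d\<close> or \<open>a\<close> below \<open>b\<close>.\<close>

lemma twisted_prime:
  assumes "a \<in> A" "b \<in> A" "c \<in> A" "d \<in> A" and *: "(a * c + b * d, a * d + b * c) \<in> P"
  shows "(a, b) \<in> P \<or> (c, d) \<in> P"
proof -
  have wlog: "(a, b) \<in> P \<or> (c, d) \<in> P"
    if mem: "a \<in> A" "b \<in> A" "c \<in> A" "d \<in> A" and le: "le b a" "le d c" 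
      and cd: "(a * c + b * d, a * d + b * c) \<in> P" for a b c d
  proof -
    have "le (a * c) (a * c + b * d)"
      using mem by (simp add: le_def refl)
    moreover have "le (a * c + b * d) (a * d + b * c)"
      using cd mem by (intro le_cong) auto
    ultimately have "le (a * c) (a * d + b * c)"
      by (rule le_trans[rotated 2]) (use mem in auto)
    then consider "le (a * c) (a * d)" | "le (c * a) (c * b)"
      using le_add_right_iff mem by (auto simp: mult.commute)
    then show ?thesis
    proof cases
      case 1
      show ?thesis
      \<comment> \<open>An entry congruent to 0 cannot be cancelled, but it forces the smaller entry
        \<open>b\<close> to 0 as well.\<close>
      proof (cases "(a, 0) \<in> P")
        case True
        then have "le b 0"
          using le_trans[OF _ _ le(1), of 0] mem by (simp add: le_zero_iff)
        then show ?thesis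
          using True trans sym unfolding le_zero_iff by blast
      next
        case False
        then show ?thesis
          using 1 le mem by (auto simp: le_mult_cancel intro: le_antisym)
      qed
    next
      case 2
      show ?thesis
      proof (cases "(c, 0) \<in> P")
        case True
        then have "le d 0"
          using le_trans[OF _ _ le(2), of 0] mem by (simp add: le_zero_iff)
        then show ?thesis
          using True trans sym unfolding le_zero_iff by blast
      next
        case False
        then show ?thesis
          using 2 le mem by (auto simp: le_mult_cancel intro: le_antisym)
      qed
    qed
  qed
  from le_total[of a b] le_total[of c d] assms(1-4) 
  consider "le b a" "le d c" | "le a b" "le d c" | "le b a" "le c d" | "le a b" "le c d" by auto
  then show ?thesis
  proof cases
    case 1
    then show ?thesis using wlog assms by blast
  next
    case 2
    then show ?thesis using wlog[of b a c d] * assms(1-4) by (metis sym add.commute)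
  next
    case 3
    then show ?thesis using wlog[of a b d c] * assms(1-4) by (metis sym add.commute)
  next
    case 4
    then show ?thesis using wlog[of b a d c] * assms(1-4) by (metis sym add.commute)
  qed
qed

lemma prime_congI:
  assumes "P \<subseteq> A \<times> A"
  shows "prime_semiring_congruence (subsemiring A) P"
  unfolding prime_semiring_congruence_def semiring_congruence_def all_pairs_def
proof (intro conjI allI impI ballI)
  show "equiv (carrier (subsemiring A)) P"
    using equiv[OF assms] by simp
  show "P \<noteq> carrier (subsemiring A) \<times> carrier (subsemiring A)"
    using proper by auto
  fix \<alpha> \<beta> 
  assume "\<alpha> \<in> carrier (subsemiring A) \<times> carrier (subsemiring A)" 
    "\<beta> \<in> carrier (subsemiring A) \<times> carrier (subsemiring A)"
    "twisted_prod (subsemiring A) \<alpha> \<beta> \<in> P"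
  then show "\<alpha> \<in> P \<or> \<beta> \<in> P"
    using twisted_prime by (cases \<alpha>; cases \<beta>) auto
qed (auto intro: add mult)

end

lemma (in idem_subsemiring) congD:
  assumes "semiring_congruence (subsemiring A) P"
  shows "cong A P" "P \<subseteq> A \<times> A"
proof -
  have eq: "equiv A P" and ops: "\<And>a b c d. (a, b) \<in> P \<Longrightarrow> (c, d) \<in> P \<Longrightarrow> 
      (a + c, b + d) \<in> P \<and> (a * c, b * d) \<in> P"
    using assms by (auto simp: semiring_congruence_def)
  show "P \<subseteq> A \<times> A" 
    using eq by (auto simp: equiv_def refl_on_def)
  show "cong A P"
    by standard (use eq ops in \<open>auto simp: equiv_def refl_on_def dest: symD transD\<close>)
qed

text \<open>Cancellation is primeness for the twisted product with a pair \<open>(c, 0)\<close>.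
  Totality comes from the product of \<open>(a + b, a)\<close> and \<open>(a + b, b)\<close>, whose
  two entries agree.\<close>

lemma (in idem_subsemiring) prime_congD:
  assumes P: "prime_semiring_congruence (subsemiring A) P"
  shows "prime_cong A P"
proof -
  have sc: "semiring_congruence (subsemiring A) P" and neq: "P \<noteq> A \<times> A"
    and *: "\<forall>\<alpha>\<in>A \<times> A. \<forall>\<beta>\<in>A \<times> A. 
      twisted_prod (subsemiring A) \<alpha> \<beta> \<in> P \<longrightarrow> \<alpha> \<in> P \<or> \<beta> \<in> P"
    using P by (simp_all add: prime_semiring_congruence_def all_pairs_def)
  have prime: "(a, b) \<in> P \<or> (c, d) \<in> P" if "a \<in> A" "b \<in> A" "c \<in> A" "d \<in> A" 
      "(a * c + b * d, a * d + b * c) \<in> P" for a b c d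
    using *[rule_format, of "(a, b)" "(c, d)"] that by simp
  interpret cong A P
    using sc by (rule congD)
  have sub: "P \<subseteq> A \<times> A"
    using sc by (rule congD)
  show ?thesis
  proof
    show "(1, 0) \<notin> P"
    proof
      assume *: "(1, 0) \<in> P"
      have "(a, b) \<in> P" if "a \<in> A" "b \<in> A" for a b
        using zero_mult[OF *, of a] zero_mult[OF *, of b] that trans sym by (metis mult_1_right)
      with neq sub show False by auto
    qed
  next
    fix a b c assume "a \<in> A" "b \<in> A" "c \<in> A" "(c * a, c * b) \<in> P"
    then show "(c, 0) \<in> P \<or> (a, b) \<in> P"
      using prime[of c 0 a b] by simp
  next
    fix a b assume ab: "a \<in> A" "b \<in> A"
    \<comment> \<open>By idempotence both entries are equal to
      \<open>a * a + a * b + b * b\<close>.\<close>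
    have "((a + b) * (a + b) + a * b, (a + b) * b + a * (a + b)) \<in> P"
    proof -
      have "a * b + (a * b + (a * b + b * b)) = a * b + (a * b + b * b)"
        using ab by (intro add_idem_left) simp
      then have "(a + b) * (a + b) + a * b = (a + b) * b + a * (a + b)"
        by (simp add: algebra_simps)
      then show ?thesis
        using ab by (auto intro: refl)
    qed
    then show "(a + b, a) \<in> P \<or> (a + b, b) \<in> P"
      using prime[of "a + b" a "a + b" b] ab by simp
  qed
qed

section \<open>Homomorphisms to the tropical semifield and the primes above their kernels\<close>

locale tropical_valuation = idem_subsemiring A for A :: "'a::comm_semiring_1 set" +
  fixes v :: "'a \<Rightarrow> tropical"
  assumes v_0: "v 0 = 0" and v_1: "v 1 = 1"
    and v_add: "v (x + y) = v x + v y" and v_mult: "v (x * y) = v x * v y"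
begin

definition ker :: "('a \<times> 'a) set" where
  "ker = {(x, y) \<in> A \<times> A. v x = v y}"

text \<open>The quotient by the kernel embeds into the tropical semifield, which is totally ordered
  and cancellative.\<close>

lemma ker_prime: "prime_semiring_congruence (subsemiring A) ker"
proof -
  interpret K: prime_cong A ker
    by standard (auto simp: ker_def v_0 v_1 v_add v_mult tropical_add_eq_max max_def
        dest: tropical_mult_left_cancel[THEN iffD1, rotated])
  show ?thesis
    by (rule K.prime_congI) (auto simp: ker_def)
qed

lemma v_power: "v (x ^ n) = v x ^ n"
  by (induction n) (auto simp: v_1 v_mult)

end

text \<open>
  Convexity of congruence classes and the archimedean property of the reals spread a single
  identification to all elements.
\<close>

lemma (in tropical_valuation) prime_above_ker:
  assumes "prime_cong A P" "ker \<subseteq> P" and ab: "(a, b) \<in> P" "a \<in> A" "b \<in> A" "v a \<noteq> v b" 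
    and c: "c \<in> A"
  shows "(c, 0) \<in> P \<or> (c, 1) \<in> P"
proof -
  interpret P: prime_cong A P by fact
  \<comment> \<open>Since \<open>P\<close> contains the kernel, its preorder extends the order of
    the values.\<close>
  have le: "P.le x y" if "x \<in> A" "y \<in> A" "v x \<le> v y" for x y
  proof -
    have "(x + y, y) \<in> ker"
      using that by (auto simp: ker_def v_add tropical_add_eq_max max_def)
    then show ?thesis
      using \<open>ker \<subseteq> P\<close> by (auto simp: P.le_def)
  qed
  have v_zero: "(x, 0) \<in> P" if "x \<in> A" "v x = 0" for x
    using le[of x 0] that by (simp add: v_0 P.le_zero_iff)
  have zero_below: "(x, 0) \<in> P" if "x \<in> A" "y \<in> A" "v x \<le> v y" "(y, 0) \<in> P" for x y
    using P.le_trans[OF that(1) zero_mem le[OF that(1-3)]] that by (simp add: P.le_zero_iff)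
  have arch: "\<exists>n. y \<le> real n * x" if "x > 0" for x y :: real
    using reals_Archimedean3[OF that] by (meson less_imp_le)
  have v1: "v 1 = TPow 0"
    by (simp add: v_1 one_tropical_def)
  show ?thesis
  proof (cases "v c = 0")
    case True
    then show ?thesis using v_zero c by blast
  next
    case False
    then obtain \<gamma> where \<gamma>: "v c = TPow \<gamma>"
      by (rule tropical_neq_0E)
    show ?thesis
    \<comment> \<open>Either \<open>P\<close> sends an element of nonzero value to 0, and powers of
      \<open>c\<close> are compared with it, or two distinct nonzero values are identified, and
      powers widen the gap between them.\<close>
    proof (cases "\<exists>z\<in>A. v z \<noteq> 0 \<and> (z, 0) \<in> P")
      case True
      then obtain z \<zeta> where z: "z \<in> A" "(z, 0) \<in> P" "v z = TPow \<zeta>"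
        by (auto elim: tropical_neq_0E)
      \<comment> \<open>Otherwise 1 would lie below \<open>z\<close> and hence be congruent to
        0.\<close>
      have "\<zeta> < 0"
        using zero_below[of 1 z] z P.proper by (auto simp: v1 simp del: not_le simp flip: not_le)
      consider "\<gamma> = 0" | "\<gamma> > 0" | "\<gamma> < 0" by linarith
      then show ?thesis
      proof cases
        case 1
        then have "(c, 1) \<in> ker"
          using c by (simp add: ker_def \<gamma> v1)
        then show ?thesis using assms(2) by auto
      next
        case 2
        \<comment> \<open>A power of \<open>c\<close> lifts \<open>z\<close> above 1, which
          contradicts properness.\<close>
        then obtain n where "- \<zeta> \<le> real n * \<gamma>"
          using arch by blast
        then have "(1, 0) \<in> P"
          using P.zero_mult[OF z(2), of "c ^ n"] c z
          by (intro zero_below[of 1 "c ^ n * z"]) (auto simp: v_mult v_power v1 \<gamma> TPow_power)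
        then show ?thesis using P.proper by blast
      next
        case 3
        \<comment> \<open>A power of \<open>c\<close> sinks below \<open>z\<close>, so this power
          and hence \<open>c\<close> itself is congruent to 0.\<close>
        then have "\<exists>n. - \<zeta> \<le> real n * (- \<gamma>)"
          by (intro arch) simp
        then obtain n where "- \<zeta> \<le> real n * (- \<gamma>)" ..
        then have "(c ^ n, 0) \<in> P"
          using c z by (intro zero_below[of "c ^ n" z]) (auto simp: v_power \<gamma> TPow_power)
        then show ?thesis
          using c P.power_zero_iff by blast
      qed
    next
      case nz: False
      have *: "(c, 1) \<in> P" if ab: "(a, b) \<in> P" "a \<in> A" "b \<in> A" "v a < v b" for a b
      proof -
        have "v b \<noteq> 0"
          using ab(4) by (metis leD tropical_zero_le)
        moreover have "v a \<noteq> 0"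
        proof
          assume "v a = 0"
          then have "(b, 0) \<in> P"
            using v_zero ab P.trans P.sym by blast
          with nz ab \<open>v b \<noteq> 0\<close> show False by blast
        qed
        ultimately obtain \<alpha> \<beta> where \<alpha>: "v a = TPow \<alpha>" and \<beta>: "v b = TPow \<beta>"
          by (meson tropical_neq_0E)
        then have "\<beta> - \<alpha> > 0"
          using ab by simp
        \<comment> \<open>The values of \<open>a ^ n\<close> and \<open>b ^ n\<close> differ by at
          least the absolute value of \<open>\<gamma>\<close>, so \<open>a ^ n * c\<close> or
          \<open>b ^ n * c\<close>, depending on the sign of \<open>\<gamma>\<close>, has a value
          between them. Convexity and cancellation then make \<open>c\<close> congruent to
          1.\<close>
        then obtain n where n: "\<bar>\<gamma>\<bar> \<le> real n * (\<beta> - \<alpha>)"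
          using arch by blast
        have abn: "(a ^ n, b ^ n) \<in> P" "a ^ n \<in> A" "b ^ n \<in> A"
          using ab P.power by auto
        have nz': "(a ^ n, 0) \<notin> P" "(b ^ n, 0) \<notin> P"
          using nz abn(2,3) by (auto simp: v_power \<alpha> \<beta> TPow_power)
        have convex: "(y, z) \<in> P" if "(x, z) \<in> P" "x \<in> A" "y \<in> A" "z \<in> A" "v x \<le> v y" "v y \<le> v z" 
          for x y z
          using le[of x y] le[of y z] that P.le_trans[of z y x] P.le_cong[of z x] P.sym 
          by (auto intro: P.le_antisym)
        show ?thesis
        proof (cases "\<gamma> \<ge> 0")
          case True
          then have "(a ^ n * c, b ^ n) \<in> P"
            using n by (intro convex[OF abn(1)]) 
              (use abn c in \<open>auto simp: v_mult v_power \<alpha> \<beta> \<gamma> TPow_power algebra_simps\<close>)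
          then have "(a ^ n * c, a ^ n * 1) \<in> P"
            using abn P.trans P.sym by (metis mult_1_right)
          then show ?thesis
            using P.cancel[of c 1 "a ^ n"] nz' c abn by auto
        next
          case False
          then have "(b ^ n * c, b ^ n) \<in> P"
            using n by (intro convex[OF abn(1)]) 
              (use abn c in \<open>auto simp: v_mult v_power \<alpha> \<beta> \<gamma> TPow_power algebra_simps\<close>)
          then show ?thesis
            using P.cancel[of c 1 "b ^ n"] nz' c abn by auto
        qed
      qed
      show ?thesis
        using *[of a b] *[of b a] ab P.sym by (meson linorder_neqE)
    qed
  qed
qed

section \<open>Dimension of the quotient\<close>

definition quotient_pullback :: "'a set \<Rightarrow> ('a \<times> 'a) set \<Rightarrow> ('a set \<times> 'a set) set \<Rightarrow> ('a \<times> 'a) set" where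
  "quotient_pullback A Q P = {(x, y) \<in> A \<times> A. (Q `` {x}, Q `` {y}) \<in> P}"

context cong
begin

context
  assumes sub: "P \<subseteq> A \<times> A"
begin

lemma quotient_add:
  assumes "x \<in> A" "y \<in> A"
  shows "P `` {x} \<oplus>\<^bsub>quotient_semiring (subsemiring A) P\<^esub> P `` {y} = P `` {x + y}"
proof -
  have "congruent2 P P (\<lambda>x y. P `` {x + y})"
    using equiv[OF sub] by (auto intro!: congruent2I' equiv_class_eq[of A] add)
  then show ?thesis
    using UN_equiv_class2[OF equiv[OF sub] equiv[OF sub]] assms by (simp add: quotient_semiring_def)
qed

lemma quotient_mult:
  assumes "x \<in> A" "y \<in> A"
  shows "P `` {x} \<otimes>\<^bsub>quotient_semiring (subsemiring A) P\<^esub> P `` {y} = P `` {x * y}"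
proof -
  have "congruent2 P P (\<lambda>x y. P `` {x * y})"
    using equiv[OF sub] by (auto intro!: congruent2I' equiv_class_eq[of A] mult)
  then show ?thesis
    using UN_equiv_class2[OF equiv[OF sub] equiv[OF sub]] assms by (simp add: quotient_semiring_def)
qed

lemma quotient_class_in: "x \<in> A \<Longrightarrow> P `` {x} \<in> carrier (quotient_semiring (subsemiring A) P)"
  by (auto simp: quotient_semiring_def intro: quotientI)

text \<open>The projection to the quotient respects twisted products; pulling back along it reduces
  chains of primes of the quotient to chains of primes of \<open>A\<close> above
  \<open>P\<close>.\<close>

lemma pullback_prime:
  assumes "prime_semiring_congruence (quotient_semiring (subsemiring A) P) P'"
  shows "prime_semiring_congruence (subsemiring A) (quotient_pullback A P P')" 
    "P \<subseteq> quotient_pullback A P P'"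
proof -
  let ?Q = "quotient_semiring (subsemiring A) P"
  let ?B = "quotient_pullback A P P'"
  have eq: "equiv (carrier ?Q) P'" and neq: "P' \<noteq> carrier ?Q \<times> carrier ?Q"
    and ops: "\<And>a b c d. (a, b) \<in> P' \<Longrightarrow> (c, d) \<in> P' \<Longrightarrow>
       (a \<oplus>\<^bsub>?Q\<^esub> c, b \<oplus>\<^bsub>?Q\<^esub> d) \<in> P' \<and> (a \<otimes>\<^bsub>?Q\<^esub> c, b \<otimes>\<^bsub>?Q\<^esub> d) \<in> P'"
    and prime: "\<forall>\<alpha>\<in>carrier ?Q \<times> carrier ?Q. \<forall>\<beta>\<in>carrier ?Q \<times> carrier ?Q. 
       twisted_prod ?Q \<alpha> \<beta> \<in> P' \<longrightarrow> \<alpha> \<in> P' \<or> \<beta> \<in> P'"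
    using assms by (simp_all add: prime_semiring_congruence_def all_pairs_def semiring_congruence_def)
  have refl': "X \<in> carrier ?Q \<Longrightarrow> (X, X) \<in> P'" for X
    using eq by (auto simp: equiv_def refl_on_def)
  have trans': "(X, Y) \<in> P' \<Longrightarrow> (Y, Z) \<in> P' \<Longrightarrow> (X, Z) \<in> P'" for X Y Z
    using eq unfolding equiv_def by (blast dest: transD)
  show PB: "P \<subseteq> ?B"
  proof
    fix z assume z: "z \<in> P"
    obtain x y where xy: "z = (x, y)" by (cases z)
    then have "P `` {x} = P `` {y}" "x \<in> A" "y \<in> A"
      using z sub equiv_class_eq[OF equiv[OF sub]] by auto
    then show "z \<in> ?B"
      using refl' quotient_class_in xy by (auto simp: quotient_pullback_def)
  qed
  have "semiring_congruence (subsemiring A) ?B"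
  proof -
    interpret B: cong A ?B
    proof
      show "(x, x) \<in> ?B" if "x \<in> A" for x
        using that refl' quotient_class_in by (auto simp: quotient_pullback_def)
      show "(y, x) \<in> ?B" if "(x, y) \<in> ?B" for x y
        using that eq by (auto simp: quotient_pullback_def equiv_def dest: symD)
      show "(x, z) \<in> ?B" if "(x, y) \<in> ?B" "(y, z) \<in> ?B" for x y z
        using that trans' by (auto simp: quotient_pullback_def)
      show "(x + x', y + y') \<in> ?B" "(x * x', y * y') \<in> ?B" 
        if "(x, y) \<in> ?B" "(x', y') \<in> ?B" for x y x' y'
        using that ops[of "P `` {x}" "P `` {y}" "P `` {x'}" "P `` {y'}"] 
        by (auto simp: quotient_pullback_def quotient_add quotient_mult)
    qed
    show ?thesis
      by (rule B.congI) (auto simp: quotient_pullback_def)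
  qed
  moreover have "?B \<noteq> A \<times> A"
  proof
    assume *: "?B = A \<times> A"
    have "carrier ?Q \<times> carrier ?Q \<subseteq> P'"
    proof clarify
      fix X Y assume "X \<in> carrier ?Q" "Y \<in> carrier ?Q"
      then obtain x y where "x \<in> A" "y \<in> A" "X = P `` {x}" "Y = P `` {y}"
        by (auto simp: quotient_semiring_def elim!: quotientE)
      then show "(X, Y) \<in> P'"
        using * by (auto simp: quotient_pullback_def)
    qed
    moreover have "P' \<subseteq> carrier ?Q \<times> carrier ?Q"
      using eq by (auto simp: equiv_def refl_on_def)
    ultimately show False
      using neq by auto
  qed
  moreover have "(a, b) \<in> ?B \<or> (c, d) \<in> ?B" 
    if "a \<in> A" "b \<in> A" "c \<in> A" "d \<in> A" "(a * c + b * d, a * d + b * c) \<in> ?B" for a b c d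
    using that prime[rule_format, of "(P `` {a}, P `` {b})" "(P `` {c}, P `` {d})"]
    by (simp add: quotient_pullback_def quotient_class_in quotient_add quotient_mult)
  ultimately show "prime_semiring_congruence (subsemiring A) ?B"
    by (auto simp: prime_semiring_congruence_def all_pairs_def)
qed

lemma pullback_strict_mono:
  assumes "prime_semiring_congruence (quotient_semiring (subsemiring A) P) P''" "P' \<subset> P''"
  shows "quotient_pullback A P P' \<subset> quotient_pullback A P P''"
proof -
  let ?Q = "quotient_semiring (subsemiring A) P"
  have "P'' \<subseteq> carrier ?Q \<times> carrier ?Q"
    using assms(1) by (auto simp: prime_semiring_congruence_def semiring_congruence_def equiv_def refl_on_def)
  moreover obtain X Y where XY: "(X, Y) \<in> P''" "(X, Y) \<notin> P'"
    using assms(2) by auto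
  ultimately obtain x y where "x \<in> A" "y \<in> A" "X = P `` {x}" "Y = P `` {y}"
    by (force simp: quotient_semiring_def elim!: quotientE)
  then have "(x, y) \<in> quotient_pullback A P P''" "(x, y) \<notin> quotient_pullback A P P'"
    using XY by (auto simp: quotient_pullback_def)
  moreover have "quotient_pullback A P P' \<subseteq> quotient_pullback A P P''"
    using assms(2) by (auto simp: quotient_pullback_def)
  ultimately show ?thesis by blast
qed

text \<open>A chain of length at least 2 in the quotient begins with three primes, whose pullbacks
  form a chain excluded by \<open>no_chain\<close>.\<close>

lemma quotient_dim_le_1:
  assumes no_chain: "\<And>P0 P1 P2. prime_semiring_congruence (subsemiring A) P0 \<Longrightarrow>
    prime_semiring_congruence (subsemiring A) P1 \<Longrightarrow> prime_semiring_congruence (subsemiring A) P2 \<Longrightarrow>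
    P \<subseteq> P0 \<Longrightarrow> P0 \<subset> P1 \<Longrightarrow> P1 \<subset> P2 \<Longrightarrow> False"
  shows "semiring_dim (quotient_semiring (subsemiring A) P) \<le> 1"
  unfolding semiring_dim_def
proof (rule Sup_least, clarify)
  let ?Q = "quotient_semiring (subsemiring A) P"
  fix n and C :: "nat \<Rightarrow> ('a set \<times> 'a set) set"
  assume C: "\<forall>i\<le>n. prime_semiring_congruence ?Q (C i)" "\<forall>i<n. C i \<subset> C (Suc i)"
  have "n \<le> 1"
  proof (rule ccontr)
    assume "\<not> n \<le> 1"
    then have "\<And>i. i \<le> 2 \<Longrightarrow> prime_semiring_congruence ?Q (C i)" 
      and "C 0 \<subset> C 1" "C 1 \<subset> C 2"
      using C by (auto simp: numeral_2_eq_2)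
    then show False
      using no_chain[of "quotient_pullback A P (C 0)" "quotient_pullback A P (C 1)" 
          "quotient_pullback A P (C 2)"] by (simp add: pullback_prime pullback_strict_mono)
  qed
  then show "enat n \<le> 1"
    by (simp add: one_enat_def)
qed

end

end

text \<open>A prime \<open>P1\<close> strictly above another one that contains the kernel identifies
  elements of different values, so modulo \<open>P1\<close> every element is congruent to 0 or 1. A
  strictly larger congruence must then identify 0 with 1.\<close>

lemma (in tropical_valuation) ker_quotient_dim_le_1:
  "semiring_dim (quotient_semiring (subsemiring A) ker) \<le> 1"
proof -
  interpret K: prime_cong A ker
    by (rule prime_congD[OF ker_prime])
  show ?thesis
  proof (rule K.quotient_dim_le_1)
    show "ker \<subseteq> A \<times> A"
      by (auto simp: ker_def)
  next
    fix P0 P1 P2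
    assume P: "prime_semiring_congruence (subsemiring A) P1" 
      "prime_semiring_congruence (subsemiring A) P2"
      and sub: "ker \<subseteq> P0" "P0 \<subset> P1" "P1 \<subset> P2"
    interpret P1: prime_cong A P1
      using P(1) by (rule prime_congD)
    interpret P2: prime_cong A P2
      using P(2) by (rule prime_congD)
    have in_A: "P1 \<subseteq> A \<times> A" "P2 \<subseteq> A \<times> A"
      using P congD(2) by (auto simp: prime_semiring_congruence_def)
    obtain a b where ab: "(a, b) \<in> P1" "(a, b) \<notin> P0"
      using sub by auto
    then have "v a \<noteq> v b" "a \<in> A" "b \<in> A"
      using sub in_A by (auto simp: ker_def)
    then have trivial: "(x, 0) \<in> P1 \<or> (x, 1) \<in> P1" if "x \<in> A" for x
      using prime_above_ker[OF P1.prime_cong_axioms _ ab(1)] sub that by blast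
    obtain c d where cd: "(c, d) \<in> P2" "(c, d) \<notin> P1"
      using sub by auto
    then have "c \<in> A" "d \<in> A"
      using in_A by auto
    with trivial[of c] trivial[of d] cd(2) 
    consider "(c, 0) \<in> P1" "(d, 1) \<in> P1" | "(c, 1) \<in> P1" "(d, 0) \<in> P1"
      using P1.trans P1.sym by blast
    then have "(1, 0) \<in> P2"
    proof cases
      case 1
      then have "(1, d) \<in> P2" "(c, 0) \<in> P2"
        using sub P2.sym by auto
      then show ?thesis 
        using P2.trans[OF P2.trans[OF _ P2.sym[OF cd(1)]]] by blast
    next
      case 2
      then have "(1, c) \<in> P2" "(d, 0) \<in> P2"
        using sub P2.sym by auto
      then show ?thesis 
        using P2.trans[OF P2.trans[OF _ cd(1)]] by blast
    qed
    then show False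
      using P2.proper by blast
  qed
qed

section \<open>Realizing a prime congruence by real weights\<close>

locale tropical_subsemifield =
  fixes F :: "tropical set"
  assumes F_0: "0 \<in> F" and F_1: "1 \<in> F"
    and F_add: "a \<in> F \<Longrightarrow> b \<in> F \<Longrightarrow> a + b \<in> F"
    and F_mult: "a \<in> F \<Longrightarrow> b \<in> F \<Longrightarrow> a * b \<in> F"
    and F_inverse: "a \<in> F \<Longrightarrow> a \<noteq> 0 \<Longrightarrow> \<exists>b\<in>F. a * b = 1"

definition formal_sum_set :: "tropical set \<Rightarrow> ('e \<Rightarrow>\<^sub>0 tropical) set" where
  "formal_sum_set F = {p. \<forall>m. Poly_Mapping.lookup p m \<in> F}"

lemma formal_sums_eq: "formal_sums F = subsemiring (formal_sum_set F)"
  by (simp add: formal_sums_def subsemiring_def formal_sum_set_def)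

text \<open>
  \<open>\<delta>\<close> embeds the exponents into integer vectors; it is \<open>lookup\<close> for Laurent polynomials and its
  composition with the inclusion of the naturals for polynomials.
\<close>

locale formal_sums_over = tropical_subsemifield F for F +
  fixes \<delta> :: "'e::comm_monoid_add \<Rightarrow> 'n::finite \<Rightarrow> int"
  assumes \<delta>_add: "\<delta> (m + m') = (\<lambda>i. \<delta> m i + \<delta> m' i)"
    and \<delta>_inj: "inj \<delta>"
begin

abbreviation "A \<equiv> formal_sum_set F :: ('e \<Rightarrow>\<^sub>0 tropical) set"

lemma single_mem: "c \<in> F \<Longrightarrow> Poly_Mapping.single m c \<in> A"
  by (auto simp: formal_sum_set_def lookup_single when_def F_0)

lemma formal_sum_set_add: "p \<in> A \<Longrightarrow> q \<in> A \<Longrightarrow> p + q \<in> A"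
  by (auto simp: formal_sum_set_def lookup_add F_add)

sublocale idem_subsemiring A
proof
  show zero: "0 \<in> A"
    by (simp add: formal_sum_set_def F_0)
  have sum: "(\<Sum>i\<in>K. f i) \<in> A" if "\<And>i. i \<in> K \<Longrightarrow> f i \<in> A" for K :: "'e set" and f
    using that by (induction K rule: infinite_finite_induct) (simp_all add: zero formal_sum_set_add)
  show "1 \<in> A"
    using single_mem[OF F_1, of 0] by simp
  show "p * q \<in> A" if "p \<in> A" "q \<in> A" for p q
    unfolding mult_eq_sum_single using that
    by (intro sum single_mem F_mult) (auto simp: formal_sum_set_def)
qed (auto simp: poly_mapping_add_idem formal_sum_set_add)

lemma \<delta>_zero: "\<delta> 0 i = 0"
  using fun_cong[OF \<delta>_add[of 0 0], of i] by simp

text \<open>A nonzero constant is a unit, so if it were congruent to 0, so would be 1.\<close>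

lemma constant_zero_iff:
  assumes P: "prime_cong A P" and c: "c \<in> F"
  shows "(Poly_Mapping.single 0 c, 0) \<in> P \<longleftrightarrow> c = 0"
proof -
  interpret P: prime_cong A P by fact
  have "(Poly_Mapping.single 0 c, 0) \<notin> P" if nz: "c \<noteq> 0"
  proof
    assume *: "(Poly_Mapping.single 0 c, 0) \<in> P"
    obtain b where b: "b \<in> F" "c * b = 1"
      using F_inverse[OF c nz] by blast
    then have "(Poly_Mapping.single 0 b * Poly_Mapping.single 0 c, 0) \<in> P"
      using P.zero_mult[OF *] single_mem by blast
    then show False
      using b P.proper by (simp add: mult_single mult.commute)
  qed
  then show ?thesis
    using P.refl[of 0] by auto
qed

text \<open>Restricted to the constants, \<open>P\<close> is a prime congruence of \<open>F\<close>
  above the kernel of the identity valuation. So \<open>prime_above_ker\<close> spreads one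
  identification of constants to all nonzero constants.\<close>

lemma constants_collapse:
  assumes P: "prime_cong A P" and c: "c \<in> F" "c' \<in> F" "c \<noteq> c'" 
    and eq: "(Poly_Mapping.single 0 c, Poly_Mapping.single 0 c') \<in> P"
    and b: "b \<in> F" "b \<noteq> 0"
  shows "(Poly_Mapping.single 0 b, 1) \<in> P"
proof -
  interpret P: prime_cong A P by fact
  define P0 where "P0 = {(x, y). (Poly_Mapping.single (0::'e) x, Poly_Mapping.single 0 y) \<in> P}"
  interpret F: tropical_valuation F id
    by standard (auto simp: F_0 F_1 F_add F_mult, simp add: tropical_add_eq_max)
  interpret P0: prime_cong F P0
  proof
    show "(x, x) \<in> P0" if "x \<in> F" for x
      using that by (auto simp: P0_def intro: P.refl single_mem)
    show "(y, x) \<in> P0" if "(x, y) \<in> P0" for x y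
      using that by (auto simp: P0_def intro: P.sym)
    show "(x, z) \<in> P0" if "(x, y) \<in> P0" "(y, z) \<in> P0" for x y z
      using that P.trans unfolding P0_def by blast
    show "(x + x', y + y') \<in> P0" if "(x, y) \<in> P0" "(x', y') \<in> P0" for x y x' y'
      using that by (auto simp: P0_def single_add intro: P.add)
    show "(x * x', y * y') \<in> P0" if "(x, y) \<in> P0" "(x', y') \<in> P0" for x y x' y'
      using that P.mult[of "Poly_Mapping.single 0 x" "Poly_Mapping.single 0 y"
          "Poly_Mapping.single 0 x'" "Poly_Mapping.single 0 y'"] 
      by (auto simp: P0_def mult_single)
    show "(1, 0) \<notin> P0"
      using P.proper by (simp add: P0_def)
    show "(c, 0) \<in> P0 \<or> (a, b) \<in> P0" 
      if "a \<in> F" "b \<in> F" "c \<in> F" "(c * a, c * b) \<in> P0" for a b c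
      using that P.cancel[of "Poly_Mapping.single 0 a" "Poly_Mapping.single 0 b"
          "Poly_Mapping.single 0 c"] 
      by (auto simp: P0_def mult_single single_mem)
    show "(a + b, a) \<in> P0 \<or> (a + b, b) \<in> P0" if "a \<in> F" "b \<in> F" for a b
      using that P.total[of "Poly_Mapping.single 0 a" "Poly_Mapping.single 0 b"] 
      by (auto simp: P0_def single_add single_mem)
  qed
  have "F.ker \<subseteq> P0"
    by (auto simp: F.ker_def intro: P0.refl)
  then have "(b, 0) \<in> P0 \<or> (b, 1) \<in> P0"
    using F.prime_above_ker[OF P0.prime_cong_axioms, of c c' b] c b(1) eq by (auto simp: P0_def)
  then show ?thesis
    using constant_zero_iff[OF P b(1)] b(2) by (auto simp: P0_def)
qed

text \<open>The preorder of \<open>P\<close> on the finitely many monomials of \<open>W\<close>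
  becomes a finite system of linear inequalities for real weights, solved by
  \<open>fourier_motzkin\<close>. Sums are compared term by term, so the weights decide every
  congruence between members of \<open>W\<close>.\<close>

lemma finite_separation:
  assumes P: "prime_cong A P" and W: "finite W" "W \<subseteq> A"
  obtains l \<chi> where "l \<in> {0, 1}" "monoid_eval (trop_scale l) \<chi>"
    "\<And>p q. p \<in> W \<Longrightarrow> q \<in> W \<Longrightarrow> 
      (p, q) \<in> P \<longleftrightarrow> eval_sum (trop_scale l) \<chi> p = eval_sum (trop_scale l) \<chi> q"
proof -
  interpret P: prime_cong A P by fact
  \<comment> \<open>Exponents outside \<open>N\<close> belong to monomials congruent to 0 and will
    be given the value 0; by cancellation \<open>N\<close> is closed under sums and
    summands.\<close>
  define N where "N = {m. (Poly_Mapping.single m 1, 0) \<notin> P}"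
  define mon where "mon = (\<lambda>(c, m::'e). Poly_Mapping.single m (TPow c))"
  define T where "T = {(c, m). TPow c \<in> F \<and> m \<in> N}"
  \<comment> \<open>If \<open>P\<close> identifies two distinct nonzero constants, the coefficients
    have to be ignored, which is the factor 0.\<close>
  define l :: real where "l = (if \<exists>c c'. TPow c \<in> F \<and> TPow c' \<in> F \<and> c \<noteq> c' \<and>
     (mon (c, 0), mon (c', 0)) \<in> P then 0 else 1)"
  have N_0: "0 \<in> N"
    using P.proper by (simp add: N_def)
  have N_add: "m + m' \<in> N \<longleftrightarrow> m \<in> N \<and> m' \<in> N" for m m'
    using P.mult_zero_iff[of "Poly_Mapping.single m 1" "Poly_Mapping.single m' 1"]
    by (simp add: N_def single_mem F_1 mult_single)
  have mon_A: "mon t \<in> A" if "t \<in> T" for t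
    using that by (auto simp: mon_def T_def intro: single_mem)
  have mon_mult: "mon (c, m) * mon (c', m') = mon (c + c', m + m')" for c m c' m'
    by (simp add: mon_def mult_single)
  have single_zero_iff: "(Poly_Mapping.single m c, 0) \<in> P \<longleftrightarrow> m \<notin> N \<or> c = 0" if "c \<in> F" for c m
  proof -
    have "Poly_Mapping.single m c = Poly_Mapping.single 0 c * Poly_Mapping.single m 1"
      by (simp add: mult_single)
    then show ?thesis
      using P.mult_zero_iff[of "Poly_Mapping.single 0 c" "Poly_Mapping.single m 1"] that
        constant_zero_iff[OF P that] by (auto simp: single_mem F_1 N_def)
  qed
  have mon_nz: "(mon t, 0) \<notin> P" if "t \<in> T" for t
    using that single_zero_iff by (auto simp: mon_def T_def)
  have T_mult: "(c + c', m + m') \<in> T" if "(c, m) \<in> T" "(c', m') \<in> T" for c m c' m'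
    using that F_mult[of "TPow c" "TPow c'"] by (auto simp: T_def N_add)

  define G where "G = {(s, l * (fst t' - fst t), \<lambda>i. \<delta> (snd t') i - \<delta> (snd t) i) | s t t'.
     t \<in> T \<and> t' \<in> T \<and> P.le (mon t) (mon t') \<and> (s \<longrightarrow> (mon t, mon t') \<notin> P)}"
  have GI: "(s, l * (c' - c), \<lambda>i. \<delta> m' i - \<delta> m i) \<in> G" 
    if "(c, m) \<in> T" "(c', m') \<in> T" "P.le (mon (c, m)) (mon (c', m'))" 
      "s \<Longrightarrow> (mon (c, m), mon (c', m')) \<notin> P" for s c c' m m'
    unfolding G_def using that 
    by (intro CollectI exI[of _ s] exI[of _ "(c, m)"] exI[of _ "(c', m')"]) auto
  have G_add: "(s \<or> s', x + x', \<lambda>i. e i + e' i) \<in> G" 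
    if G: "(s, x, e) \<in> G" "(s', x', e') \<in> G" for s x e s' x' e'
  proof -
    obtain c1 m1 c2 m2 where 1: "(c1, m1) \<in> T" "(c2, m2) \<in> T" "P.le (mon (c1, m1)) (mon (c2, m2))"
      "s \<longrightarrow> (mon (c1, m1), mon (c2, m2)) \<notin> P" "x = l * (c2 - c1)" "e = (\<lambda>i. \<delta> m2 i - \<delta> m1 i)"
      using G(1) by (auto simp: G_def)
    obtain c3 m3 c4 m4 where 2: "(c3, m3) \<in> T" "(c4, m4) \<in> T" "P.le (mon (c3, m3)) (mon (c4, m4))"
      "s' \<longrightarrow> (mon (c3, m3), mon (c4, m4)) \<notin> P" "x' = l * (c4 - c3)" "e' = (\<lambda>i. \<delta> m4 i - \<delta> m3 i)"
      using G(2) by (auto simp: G_def)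
    have "P.le (mon (c1 + c3, m1 + m3)) (mon (c2 + c4, m2 + m4))"
      using 1 2 mon_A by (auto simp flip: mon_mult intro: P.le_mult_mono)
    moreover have "(mon (c1 + c3, m1 + m3), mon (c2 + c4, m2 + m4)) \<notin> P" if "s \<or> s'"
    proof
      assume *: "(mon (c1 + c3, m1 + m3), mon (c2 + c4, m2 + m4)) \<in> P"
      have mem: "mon (c1, m1) \<in> A" "mon (c2, m2) \<in> A" "mon (c3, m3) \<in> A" "mon (c4, m4) \<in> A"
        using 1 2 by (auto intro: mon_A)
      have "(mon (c1, m1), mon (c2, m2)) \<in> P"
        using * by (intro P.mult_strict[OF mem 1(3) 2(3) mon_nz[OF 2(1)]]) (simp only: mon_mult)
      moreover have "(mon (c3, m3), mon (c4, m4)) \<in> P"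
        using * by (intro P.mult_strict[OF mem(3,4,1,2) 2(3) 1(3) mon_nz[OF 1(1)]]) 
          (simp only: mon_mult add.commute)
      ultimately show False
        using that 1 2 by blast
    qed
    ultimately have "(s \<or> s', l * ((c2 + c4) - (c1 + c3)), \<lambda>i. \<delta> (m2 + m4) i - \<delta> (m1 + m3) i) \<in> G"
      using 1 2 by (intro GI T_mult)
    also have "l * ((c2 + c4) - (c1 + c3)) = x + x'"
      by (simp add: 1 2 algebra_simps)
    also have "(\<lambda>i. \<delta> (m2 + m4) i - \<delta> (m1 + m3) i) = (\<lambda>i. e i + e' i)"
      by (simp add: 1 2 \<delta>_add fun_eq_iff)
    finally show ?thesis .
  qed
  have G_const: "positive_upto s x" if G: "(s, x, \<lambda>_. 0) \<in> G" for s x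
  proof -
    obtain c m c' m' where *: "(c, m) \<in> T" "(c', m') \<in> T" "P.le (mon (c, m)) (mon (c', m'))"
      "s \<longrightarrow> (mon (c, m), mon (c', m')) \<notin> P" "x = l * (c' - c)" "(\<lambda>_. 0) = (\<lambda>i. \<delta> m' i - \<delta> m i)"
      using G by (auto simp: G_def)
    \<comment> \<open>A constraint without weights compares two monomials of the same exponent;
      cancelling it leaves a comparison of constants.\<close>
    have "\<delta> m' = \<delta> m"
      using fun_cong[OF *(6)] by auto
    then have m': "m' = m"
      using \<delta>_inj by (simp add: inj_def)
    have F: "TPow c \<in> F" "TPow c' \<in> F" and "m \<in> N"
      using * by (auto simp: T_def)
    have split: "mon (a, m) = Poly_Mapping.single m 1 * mon (a, 0)" for a
      by (simp add: mon_def mult_single)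
    have cA: "mon (c, 0) \<in> A" "mon (c', 0) \<in> A" "Poly_Mapping.single m 1 \<in> A"
      using F by (auto simp: mon_def single_mem F_1)
    have le: "P.le (mon (c, 0)) (mon (c', 0))"
      using *(3) cA \<open>m \<in> N\<close> unfolding m' split[of c] split[of c'] 
      by (subst (asm) P.le_mult_cancel) (auto simp: N_def)
    have strict: "(mon (c, 0), mon (c', 0)) \<notin> P" if s
      using *(4) that P.mult[OF P.refl[OF cA(3)]] unfolding m' split[of c] split[of c'] by blast
    show ?thesis
    \<comment> \<open>If distinct constants are identified, no comparison of constants is strict and
      \<open>l = 0\<close>; otherwise the preorder on the constants is their numerical
      order.\<close>
    proof (cases "\<exists>c c'. TPow c \<in> F \<and> TPow c' \<in> F \<and> c \<noteq> c' \<and> (mon (c, 0), mon (c', 0)) \<in> P")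
      case True
      then have collapse: "(mon (b, 0), 1) \<in> P" if "TPow b \<in> F" for b
        using constants_collapse[OF P, of "TPow _" "TPow _" "TPow b"] that 
        by (auto simp: mon_def)
      have "\<not> s"
        using strict collapse[OF F(1)] P.trans P.sym collapse[OF F(2)] by blast
      moreover have "l = 0"
        using True by (simp add: l_def)
      ultimately show ?thesis
        by (simp add: positive_upto_def *)
    next
      case False
      then have "l = 1"
        unfolding l_def by (rule if_not_P)
      have "c \<le> c'"
      proof (rule ccontr)
        assume "\<not> c \<le> c'"
        then have "mon (c', 0) + mon (c, 0) = mon (c, 0)"
          by (simp add: mon_def max_def flip: single_add)
        then have "P.le (mon (c', 0)) (mon (c, 0))"
          using cA by (simp add: P.le_def P.refl)
        then have "(mon (c, 0), mon (c', 0)) \<in> P"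
          using le by (rule P.le_antisym[rotated])
        then show False
          using False F \<open>\<not> c \<le> c'\<close> by (metis order.refl)
      qed
      moreover have "c \<noteq> c'" if s
        using strict[OF that] cA P.refl by auto
      ultimately show ?thesis
        by (auto simp: positive_upto_def * \<open>l = 1\<close>)
    qed
  qed

  define T0 where "T0 = {(c, m). m \<in> N \<and> (\<exists>p\<in>W. Poly_Mapping.lookup p m = TPow c)}"
  have "T0 \<subseteq> (\<Union>p\<in>W. (\<lambda>m. (THE c. Poly_Mapping.lookup p m = TPow c, m)) ` Poly_Mapping.keys p)"
  proof
    fix t assume "t \<in> T0"
    then obtain c m p where t: "t = (c, m)" "p \<in> W" "Poly_Mapping.lookup p m = TPow c"
      by (auto simp: T0_def)
    then have "m \<in> Poly_Mapping.keys p"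
      by (simp add: in_keys_iff)
    then show "t \<in> (\<Union>p\<in>W. (\<lambda>m. (THE c. Poly_Mapping.lookup p m = TPow c, m)) ` Poly_Mapping.keys p)"
      using t by (force intro!: image_eqI)
  qed
  then have "finite T0"
    by (rule finite_subset) (use W in auto)
  have lookup_F: "Poly_Mapping.lookup p m \<in> F" if "p \<in> W" for p m
    using that W by (auto simp: formal_sum_set_def)
  have T0T: "T0 \<subseteq> T"
  proof (clarsimp simp: T0_def T_def)
    show "TPow c \<in> F" if "p \<in> W" "Poly_Mapping.lookup p m = TPow c" for p c m
      using lookup_F[OF that(1), of m] that(2) by simp
  qed
  \<comment> \<open>Both flags are tried for every pair from \<open>T0\<close>; intersecting with
    \<open>G\<close> keeps the constraints derived from \<open>P\<close>.\<close>
  define D where "D = G \<inter> 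
    (\<lambda>(s, t, t'). (s, l * (fst t' - fst t), \<lambda>i. \<delta> (snd t') i - \<delta> (snd t) i)) ` (UNIV \<times> T0 \<times> T0)"
  have "finite D" "D \<subseteq> G"
    using \<open>finite T0\<close> by (auto simp: D_def)
  from fourier_motzkin[OF G_add G_const this] obtain w where
    w: "\<And>s c m. (s, c, m) \<in> D \<Longrightarrow> positive_upto s (c + (\<Sum>i\<in>UNIV. w i * of_int (m i)))"
    by blast
  define wt where "wt = (\<lambda>m. \<Sum>i\<in>UNIV. w i * of_int (\<delta> m i))"
  have w': "positive_upto s ((l * c' + wt m') - (l * c + wt m))"
    if t: "(c, m) \<in> T0" "(c', m') \<in> T0" "P.le (mon (c, m)) (mon (c', m'))" 
      "s \<Longrightarrow> (mon (c, m), mon (c', m')) \<notin> P" for s c c' m m'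
  proof -
    have "(s, l * (c' - c), \<lambda>i. \<delta> m' i - \<delta> m i) \<in> D"
      unfolding D_def using t T0T by (intro IntI GI image_eqI[of _ _ "(s, (c, m), (c', m'))"]) auto
    from w[OF this] show ?thesis
      by (simp add: wt_def sum_subtractf algebra_simps)
  qed
  have order: "P.le (mon (c, m)) (mon (c', m')) \<longleftrightarrow> l * c + wt m \<le> l * c' + wt m'"
    if t: "(c, m) \<in> T0" "(c', m') \<in> T0" for c c' m m'
  proof
    show "P.le (mon (c, m)) (mon (c', m')) \<Longrightarrow> l * c + wt m \<le> l * c' + wt m'"
      using w'[OF t, of False] by (simp add: positive_upto_def)
  next
    assume *: "l * c + wt m \<le> l * c' + wt m'"
    show "P.le (mon (c, m)) (mon (c', m'))"
    \<comment> \<open>If the inequality fails modulo \<open>P\<close>, the reversed one is strict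
      modulo \<open>P\<close>, and its strict constraint contradicts the order of the
      weights.\<close>
    proof (rule ccontr)
      assume nle: "\<not> P.le (mon (c, m)) (mon (c', m'))"
      moreover have mem: "mon (c, m) \<in> A" "mon (c', m') \<in> A"
        using t T0T mon_A by blast+
      ultimately have "P.le (mon (c', m')) (mon (c, m))" "(mon (c', m'), mon (c, m)) \<notin> P"
        using P.le_total[OF mem] P.le_cong[OF mem] P.sym by auto
      then show False
        using w'[OF t(2,1), of True] * by (auto simp: positive_upto_def)
    qed
  qed

  define \<chi> where "\<chi> m = (if m \<in> N then TPow (wt m) else 0)" for m
  have l: "l \<in> {0, 1}"
    by (simp add: l_def)
  interpret ev: monoid_eval "trop_scale l" \<chi>
  proof
    show "trop_scale l (a + b) = trop_scale l a + trop_scale l b" for a b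
      by (rule trop_scale_add) (use l in auto)
    show "\<chi> 0 = 1"
      using N_0 by (simp add: \<chi>_def wt_def \<delta>_zero one_tropical_def)
    show "\<chi> (m + m') = \<chi> m * \<chi> m'" for m m'
      by (auto simp: \<chi>_def N_add wt_def \<delta>_add sum.distrib algebra_simps)
  qed (simp_all add: trop_scale_mult)
  \<comment> \<open>A sum is below \<open>q\<close> when each term is, and by totality a term not
    congruent to 0 is below \<open>q\<close> when it is below some term of \<open>q\<close>.
    Tropical values obey the same two rules, so the comparison of sums reduces to
    \<open>order\<close>.\<close>
  have le_iff: "P.le p q \<longleftrightarrow> ev.ev p \<le> ev.ev q" if pq: "p \<in> W" "q \<in> W" for p q
  proof -
    have term_mem: "Poly_Mapping.single m (Poly_Mapping.lookup r m) \<in> A" if "r \<in> W" for m r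
      using that by (intro single_mem lookup_F)
    have "P.le p q \<longleftrightarrow> (\<forall>m\<in>Poly_Mapping.keys p. P.le (Poly_Mapping.single m (Poly_Mapping.lookup p m)) q)"
      using pq W term_mem P.le_sum_iff[of "Poly_Mapping.keys p" 
        "\<lambda>m. Poly_Mapping.single m (Poly_Mapping.lookup p m)" q]
      by (auto simp: sum_single_lookup)
    also have "\<dots> \<longleftrightarrow> (\<forall>m\<in>Poly_Mapping.keys p. trop_scale l (Poly_Mapping.lookup p m) * \<chi> m \<le> ev.ev q)"
    proof (intro ball_cong refl)
      fix m assume m: "m \<in> Poly_Mapping.keys p"
      let ?t = "Poly_Mapping.single m (Poly_Mapping.lookup p m)"
      show "P.le ?t q \<longleftrightarrow> trop_scale l (Poly_Mapping.lookup p m) * \<chi> m \<le> ev.ev q"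
      proof (cases "m \<in> N")
        case False
        then have "(?t, 0) \<in> P"
          using pq by (simp add: single_zero_iff lookup_F)
        then have "P.le ?t q"
          using pq W term_mem P.le_trans[of ?t q 0] P.zero_le[of q] by (auto simp: P.le_zero_iff)
        then show ?thesis
          using False by (simp add: \<chi>_def)
      next
        case True
        obtain c where c: "Poly_Mapping.lookup p m = TPow c"
          using m by (auto simp: in_keys_iff elim: tropical_neq_0E)
        have t: "(c, m) \<in> T0" "?t = mon (c, m)"
          using c True pq by (auto simp: T0_def mon_def)
        have nz: "(?t, 0) \<notin> P"
          using t T0T mon_nz by auto
        have "P.le ?t q \<longleftrightarrow> 
          (\<exists>m'\<in>Poly_Mapping.keys q. P.le ?t (Poly_Mapping.single m' (Poly_Mapping.lookup q m')))"
          using pq nz term_mem P.le_sum_right_iff[of "Poly_Mapping.keys q" 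
            "\<lambda>m. Poly_Mapping.single m (Poly_Mapping.lookup q m)" ?t]
          by (auto simp: sum_single_lookup)
        also have "\<dots> \<longleftrightarrow> (\<exists>m'\<in>Poly_Mapping.keys q. 
            TPow (l * c + wt m) \<le> trop_scale l (Poly_Mapping.lookup q m') * \<chi> m')"
        proof (intro bex_cong refl)
          fix m' assume m': "m' \<in> Poly_Mapping.keys q"
          let ?t' = "Poly_Mapping.single m' (Poly_Mapping.lookup q m')"
          obtain c' where c': "Poly_Mapping.lookup q m' = TPow c'"
            using m' by (auto simp: in_keys_iff elim: tropical_neq_0E)
          show "P.le ?t ?t' \<longleftrightarrow> TPow (l * c + wt m) \<le> trop_scale l (Poly_Mapping.lookup q m') * \<chi> m'"
          proof (cases "m' \<in> N")
            case True
            then have t': "(c', m') \<in> T0" "?t' = mon (c', m')"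
              using c' pq by (auto simp: T0_def mon_def)
            then show ?thesis
              using order[OF t(1) t'(1)] True unfolding t t' by (simp add: \<chi>_def c')
          next
            case False
            then have "(?t', 0) \<in> P"
              using pq by (simp add: single_zero_iff lookup_F)
            then have "\<not> P.le ?t ?t'"
              using nz P.le_trans[of ?t 0 ?t'] term_mem pq by (auto simp: P.le_zero_iff P.le_cong)
            then show ?thesis
              using False by (simp add: \<chi>_def)
          qed
        qed
        also have "\<dots> \<longleftrightarrow> TPow (l * c + wt m) \<le> ev.ev q"
          unfolding eval_sum_def by (rule tropical_le_sum_iff[symmetric]) auto
        finally show ?thesis
          using True c by (simp add: \<chi>_def)
      qed
    qed
    also have "\<dots> \<longleftrightarrow> ev.ev p \<le> ev.ev q"
      by (simp add: eval_sum_def[of _ _ p] tropical_sum_le_iff)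
    finally show ?thesis .
  qed
  have "(p, q) \<in> P \<longleftrightarrow> ev.ev p = ev.ev q" if "p \<in> W" "q \<in> W" for p q
    using le_iff[OF that] le_iff[OF that(2,1)] that W P.le_antisym[of p q] P.le_cong[of p q] 
      P.le_cong[of q p] P.sym[of p q] by auto
  with l ev.monoid_eval_axioms show thesis
    by (rule that)
qed

text \<open>Finite generation enters here: \<open>W\<close> consists of the entries of the
  generators together with \<open>f\<close> and \<open>g\<close>. The kernel of the resulting
  evaluation contains the generators and therefore all of \<open>E\<close>.\<close>

lemma fin_gen_separation:
  assumes E: "fin_gen_congruence (subsemiring A) E" and P: "prime_semiring_congruence (subsemiring A) P"
    and EP: "E \<subseteq> P" and fg: "f \<in> A" "g \<in> A" "(f, g) \<notin> P"
  obtains l \<chi> where "l \<in> {0, 1}" "monoid_eval (trop_scale l) \<chi>"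
    "\<And>p q. (p, q) \<in> E \<Longrightarrow> eval_sum (trop_scale l) \<chi> p = eval_sum (trop_scale l) \<chi> q"
    "eval_sum (trop_scale l) \<chi> f \<noteq> eval_sum (trop_scale l) \<chi> g"
proof -
  obtain S where S: "finite S" "S \<subseteq> E" 
    and gen: "\<And>J. semiring_congruence (subsemiring A) J \<Longrightarrow> S \<subseteq> J \<Longrightarrow> E \<subseteq> J"
    and Ec: "semiring_congruence (subsemiring A) E"
    using E by (auto simp: fin_gen_congruence_def)
  have EA: "E \<subseteq> A \<times> A"
    using Ec by (rule congD)
  define W where "W = fst ` S \<union> snd ` S \<union> {f, g}"
  have "finite W" "W \<subseteq> A"
    using S EA fg by (auto simp: W_def)
  then obtain l \<chi> where l: "l \<in> {0, 1}" and me: "monoid_eval (trop_scale l) \<chi>"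
    and iff: "\<And>p q. p \<in> W \<Longrightarrow> q \<in> W \<Longrightarrow> 
      (p, q) \<in> P \<longleftrightarrow> eval_sum (trop_scale l) \<chi> p = eval_sum (trop_scale l) \<chi> q"
    using finite_separation[OF prime_congD[OF P]] by metis
  interpret ev: monoid_eval "trop_scale l" \<chi> by fact
  interpret val: tropical_valuation A ev.ev
    by standard (auto simp: ev.ev_zero ev.ev_one ev.ev_add ev.ev_mult)
  have "S \<subseteq> val.ker"
  proof
    fix z assume z: "z \<in> S"
    then have "fst z \<in> W" "snd z \<in> W" "z \<in> P" "z \<in> A \<times> A"
      using S EP EA by (auto simp: W_def)
    then show "z \<in> val.ker"
      using iff[of "fst z" "snd z"] by (cases z) (auto simp: val.ker_def)
  qed
  then have "E \<subseteq> val.ker"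
    using gen val.ker_prime by (simp add: prime_semiring_congruence_def)
  moreover have "ev.ev f \<noteq> ev.ev g"
    using iff[of f g] fg by (simp add: W_def)
  ultimately show thesis
    using that[OF l me] by (auto simp: val.ker_def)
qed

text \<open>A prime above \<open>E\<close> that misses a pair can be replaced by the kernel of an
  evaluation that misses the same pair, and the quotient by such a kernel has dimension at most
  1.\<close>

lemma radical_eq_dim_le_1:
  assumes E: "fin_gen_congruence (subsemiring A) E"
  shows "congruence_radical (subsemiring A) E = congruence_Inter (subsemiring A)
    {P. prime_semiring_congruence (subsemiring A) P \<and> E \<subseteq> P \<and> 
      semiring_dim (quotient_semiring (subsemiring A) P) \<le> 1}" (is "_ = congruence_Inter _ ?C")
proof
  show "congruence_radical (subsemiring A) E \<subseteq> congruence_Inter (subsemiring A) ?C"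
    by (auto simp: congruence_radical_def congruence_Inter_def)
next
  have EA: "E \<subseteq> A \<times> A"
    using E congD(2) by (auto simp: fin_gen_congruence_def)
  show "congruence_Inter (subsemiring A) ?C \<subseteq> congruence_radical (subsemiring A) E"
  proof clarify
    fix f g assume fg: "(f, g) \<in> congruence_Inter (subsemiring A) ?C"
    then have fgA: "f \<in> A" "g \<in> A"
      by (auto simp: congruence_Inter_def all_pairs_def)
    have "(f, g) \<in> P" if P: "prime_semiring_congruence (subsemiring A) P" "E \<subseteq> P" for P
    proof (rule ccontr)
      assume "(f, g) \<notin> P"
      then obtain l \<chi> where me: "monoid_eval (trop_scale l) \<chi>"
        and eq: "\<And>p q. (p, q) \<in> E \<Longrightarrow> eval_sum (trop_scale l) \<chi> p = eval_sum (trop_scale l) \<chi> q"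
        and neq: "eval_sum (trop_scale l) \<chi> f \<noteq> eval_sum (trop_scale l) \<chi> g"
        using fin_gen_separation[OF E P fgA] by metis
      interpret ev: monoid_eval "trop_scale l" \<chi> by fact
      interpret val: tropical_valuation A ev.ev
        by standard (auto simp: ev.ev_zero ev.ev_one ev.ev_add ev.ev_mult)
      have "val.ker \<in> ?C"
        using EA eq by (auto simp: val.ker_prime val.ker_quotient_dim_le_1) (auto simp: val.ker_def)
      then have "(f, g) \<in> val.ker"
        using fg by (auto simp: congruence_Inter_def)
      then show False
        using neq by (simp add: val.ker_def)
    qed
    then show "(f, g) \<in> congruence_radical (subsemiring A) E"
      using fgA by (auto simp: congruence_radical_def congruence_Inter_def all_pairs_def)
  qed
qed

end

section \<open>The radical in terms of powers\<close>

text \<open>Two translations compose: \<open>x + x'\<close> is related to \<open>x + y'\<close> and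
  this to \<open>y + y'\<close>, and likewise for products. The relations constructed below are
  easier to check one argument at a time.\<close>

lemma (in idem_subsemiring) cong_by_translations:
  assumes "J \<subseteq> A \<times> A" and refl: "\<And>x. x \<in> A \<Longrightarrow> (x, x) \<in> J"
    and sym: "\<And>x y. (x, y) \<in> J \<Longrightarrow> (y, x) \<in> J"
    and trans: "\<And>x y z. (x, y) \<in> J \<Longrightarrow> (y, z) \<in> J \<Longrightarrow> (x, z) \<in> J"
    and add: "\<And>x y z. (x, y) \<in> J \<Longrightarrow> z \<in> A \<Longrightarrow> (z + x, z + y) \<in> J"
    and mult: "\<And>x y z. (x, y) \<in> J \<Longrightarrow> z \<in> A \<Longrightarrow> (z * x, z * y) \<in> J"
  shows "cong A J"
proof
  fix x y x' y' assume *: "(x, y) \<in> J" "(x', y') \<in> J"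
  then have "x \<in> A" "y' \<in> A"
    using assms(1) by auto
  show "(x + x', y + y') \<in> J"
    using trans[OF add[OF *(2) \<open>x \<in> A\<close>]] add[OF *(1) \<open>y' \<in> A\<close>] by (simp add: add.commute)
  show "(x * x', y * y') \<in> J"
    using trans[OF mult[OF *(2) \<open>x \<in> A\<close>]] mult[OF *(1) \<open>y' \<in> A\<close>] by (simp add: mult.commute)
qed (fact refl sym trans)+

context cong
begin

lemma le_add_left: "x \<in> A \<Longrightarrow> y \<in> A \<Longrightarrow> le x (x + y)"
  by (simp add: le_def refl)

text \<open>By its degree, every monomial in the expansion of \<open>(a + b) ^ (n + m)\<close>
  contains \<open>a ^ n\<close> or \<open>b ^ m\<close>. The induction splits off one factor
  \<open>a\<close> or \<open>b\<close> at a time and lowers the corresponding exponent.\<close>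

lemma le_mult_add_power:
  assumes "a \<in> A" "b \<in> A" "f \<in> A" "g \<in> A"
    and "le (f * a ^ n) (g * (a + b) ^ n)" "le (f * b ^ m) (g * (a + b) ^ m)"
  shows "le (f * (a + b) ^ (n + m)) (g * (a + b) ^ (n + m))"
  using assms(3-)
proof (induction "n + m" arbitrary: f g n m)
  case 0
  then show ?case by simp
next
  case (Suc k)
  let ?p = "a + b"
  have p: "?p \<in> A" "le a ?p" "le b ?p"
    using assms(1,2) le_add_left[of a b] le_add_left[of b a] by (auto simp: add.commute)
  show ?case
  proof (cases "n = 0 \<or> m = 0")
    case True
    then have "le f g"
      using Suc by auto
    then show ?thesis
      using le_mult_left[of "?p ^ (n + m)" f g] p by (simp add: mult.commute)
  next
    case False
    then obtain n' m' where nm: "n = Suc n'" "m = Suc m'"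
      using not0_implies_Suc by blast
    \<comment> \<open>When a factor \<open>c\<close> is absorbed into \<open>f\<close> and
      \<open>a + b\<close> into \<open>g\<close>, the hypothesis for the other base survives because
      \<open>c\<close> is below \<open>a + b\<close>.\<close>
    have mono: "le (f * c * x ^ j) (g * ?p * ?p ^ j)" 
      if "le (f * x ^ j) (g * ?p ^ j)" "c \<in> A" "le c ?p" "x \<in> A" for c x j
      using le_mult_mono[OF _ _ _ _ that(3,1)] that Suc.prems p by (simp add: mult_ac)
    have "le (f * a * ?p ^ (n' + m)) (g * ?p * ?p ^ (n' + m))"
      by (rule Suc.hyps) (use Suc nm p assms(1,2) mono[of b m a] in \<open>auto simp: mult.assoc\<close>)
    moreover have "le (f * b * ?p ^ (n + m')) (g * ?p * ?p ^ (n + m'))"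
      by (rule Suc.hyps) (use Suc nm p assms(1,2) mono[of a n b] in \<open>auto simp: mult.assoc\<close>)
    ultimately have "le (f * a * ?p ^ (n' + m) + f * b * ?p ^ (n' + m)) (g * ?p * ?p ^ (n' + m))"
      using Suc.prems nm p assms(1,2) by (subst le_add_iff) auto
    then show ?thesis
      using nm by (simp add: algebra_simps)
  qed
qed

end

text \<open>
  The prime congruence is a maximal congruence among those that contain no multiple of \<open>(f, g)\<close> by
  an element \<open>(f + g)\<^sup>i + h\<close>.
\<close>

lemma (in cong) prime_excluding:
  assumes P: "P \<subseteq> A \<times> A" and fg: "f \<in> A" "g \<in> A"
    and excl: "\<And>i h. h \<in> A \<Longrightarrow> (((f + g) ^ i + h) * f, ((f + g) ^ i + h) * g) \<notin> P"
  obtains I where "prime_semiring_congruence (subsemiring A) I" "P \<subseteq> I" "(f, g) \<notin> I"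
proof -
  define s where "s = f + g"
  \<comment> \<open>\<open>U\<close> contains 1, is multiplicatively closed, and is stable under
    \<open>u \<mapsto> u * s + c\<close> for \<open>c\<close> in \<open>A\<close>, which is what the
    free summand \<open>h\<close> provides.\<close>
  define U where "U = {s ^ i + h | i h. h \<in> A}"
  have sA: "s \<in> A"
    using fg by (simp add: s_def)
  have U_A: "u \<in> A" if "u \<in> U" for u
    using that sA by (auto simp: U_def)
  have U_1: "1 \<in> U"
    unfolding U_def by (rule CollectI, rule exI[of _ 0], rule exI[of _ 0]) simp
  have U_mult: "u * v \<in> U" if uv: "u \<in> U" "v \<in> U" for u v
  proof -
    obtain i h j k where "u = s ^ i + h" "v = s ^ j + k" "h \<in> A" "k \<in> A"
      using uv by (auto simp: U_def)
    moreover from this have "u * v = s ^ (i + j) + (s ^ i * k + h * s ^ j + h * k)"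
      by (simp add: algebra_simps power_add)
    ultimately show ?thesis
      unfolding U_def using sA 
      by (intro CollectI exI[of _ "i + j"] exI[of _ "s ^ i * k + h * s ^ j + h * k"]) auto
  qed
  have U_add: "u * s + c \<in> U" if uc: "u \<in> U" "c \<in> A" for u c
  proof -
    obtain i h where "u = s ^ i + h" "h \<in> A"
      using uc by (auto simp: U_def)
    moreover from this have "u * s + c = s ^ Suc i + (h * s + c)"
      by (simp add: algebra_simps)
    ultimately show ?thesis
      unfolding U_def using sA uc by (intro CollectI exI[of _ "Suc i"] exI[of _ "h * s + c"]) auto
  qed
  define \<F> where "\<F> = {I. P \<subseteq> I \<and> I \<subseteq> A \<times> A \<and> cong A I \<and> (\<forall>u\<in>U. (u * f, u * g) \<notin> I)}"
  have "P \<in> \<F>"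
    using P excl cong_axioms by (auto simp: \<F>_def U_def s_def)
  moreover have "\<Union>\<C> \<in> \<F>" if C: "\<C> \<noteq> {}" "subset.chain \<F> \<C>" for \<C>
  proof -
    have CF: "\<C> \<subseteq> \<F>" and lin: "\<And>X Y. X \<in> \<C> \<Longrightarrow> Y \<in> \<C> \<Longrightarrow> X \<subseteq> Y \<or> Y \<subseteq> X"
      using C by (auto simp: subset_chain_def)
    have cg: "X \<in> \<C> \<Longrightarrow> cong A X" for X
      using CF by (auto simp: \<F>_def)
    have common: "\<exists>X\<in>\<C>. z \<in> X \<and> z' \<in> X" if z: "z \<in> \<Union>\<C>" "z' \<in> \<Union>\<C>" for z z'
    proof -
      obtain X Y where "X \<in> \<C>" "Y \<in> \<C>" "z \<in> X" "z' \<in> Y"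
        using z by auto
      then show ?thesis
        using lin[of X Y] by blast
    qed
    have "cong A (\<Union>\<C>)"
    proof
      show "(x, x) \<in> \<Union>\<C>" if "x \<in> A" for x
        using C(1) cg cong.refl that by blast
      show "(y, x) \<in> \<Union>\<C>" if "(x, y) \<in> \<Union>\<C>" for x y
        using that cg cong.sym by blast
      show "(x, z) \<in> \<Union>\<C>" if "(x, y) \<in> \<Union>\<C>" "(y, z) \<in> \<Union>\<C>" for x y z
        using common[OF that] cg cong.trans by blast
      show "(x + x', y + y') \<in> \<Union>\<C>" if "(x, y) \<in> \<Union>\<C>" "(x', y') \<in> \<Union>\<C>" for x y x' y'
        using common[OF that] cg cong.add by blast
      show "(x * x', y * y') \<in> \<Union>\<C>" if "(x, y) \<in> \<Union>\<C>" "(x', y') \<in> \<Union>\<C>" for x y x' y'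
        using common[OF that] cg cong.mult by blast
    qed
    then show ?thesis
      using C(1) CF by (fastforce simp: \<F>_def)
  qed
  ultimately obtain I where I: "I \<in> \<F>" and max: "\<And>J. J \<in> \<F> \<Longrightarrow> I \<subseteq> J \<Longrightarrow> J = I"
    using subset_Zorn_nonempty[of \<F>] by blast
  have PI: "P \<subseteq> I" and IA: "I \<subseteq> A \<times> A" and excl: "\<And>u. u \<in> U \<Longrightarrow> (u * f, u * g) \<notin> I"
    using I by (auto simp: \<F>_def)
  interpret I: cong A I
    using I by (simp add: \<F>_def)
  have maxD: "\<exists>u\<in>U. (u * f, u * g) \<in> J" 
    if "cong A J" "I \<subseteq> J" "J \<subseteq> A \<times> A" "(x, y) \<in> J" "(x, y) \<notin> I" for J x y
  proof (rule ccontr)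
    assume "\<not> ?thesis"
    then have "J \<in> \<F>"
      using that PI by (auto simp: \<F>_def)
    then show False
      using max that by blast
  qed
  have mult_left: "(z * x, z * y) \<in> I" if "(x, y) \<in> I" "z \<in> A" for x y z
    using I.mult[OF I.refl that(1)] that(2) by blast
  have add_left: "(z + x, z + y) \<in> I" if "(x, y) \<in> I" "z \<in> A" for x y z
    using I.add[OF I.refl that(1)] that(2) by blast
  \<comment> \<open>The saturation of \<open>I\<close> by \<open>U\<close> is a congruence that
    still contains no \<open>U\<close>-multiple of \<open>(f, g)\<close>, since \<open>U\<close> is
    multiplicatively closed. By maximality it is no larger than \<open>I\<close>.\<close>
  have U_cancel: "(x, y) \<in> I" if u: "u \<in> U" "x \<in> A" "y \<in> A" "(u * x, u * y) \<in> I" for u x y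
  proof (rule ccontr)
    assume nI: "(x, y) \<notin> I"
    define J where "J = {(x, y) \<in> A \<times> A. \<exists>u\<in>U. (u * x, u * y) \<in> I}"
    have JI: "\<exists>u\<in>U. (u * x, u * y) \<in> I" if "(x, y) \<in> J" for x y
      using that by (auto simp: J_def)
    have J_intro: "(x, y) \<in> J" if "u \<in> U" "(u * x, u * y) \<in> I" "x \<in> A" "y \<in> A" for u x y
      using that by (auto simp: J_def)
    have J_A: "x \<in> A \<and> y \<in> A" if "(x, y) \<in> J" for x y
      using that by (auto simp: J_def)
    have "cong A J"
    proof (rule cong_by_translations)
      show "J \<subseteq> A \<times> A" 
        by (auto simp: J_def)
      show "(x, x) \<in> J" if "x \<in> A" for x
        using that U_1 by (auto intro!: J_intro[OF U_1] I.refl)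
      show "(y, x) \<in> J" if "(x, y) \<in> J" for x y
        using JI[OF that] J_A[OF that] J_intro I.sym by blast
      show "(x, z) \<in> J" if xy: "(x, y) \<in> J" and yz: "(y, z) \<in> J" for x y z
      proof -
        obtain u v where uv: "u \<in> U" "(u * x, u * y) \<in> I" "v \<in> U" "(v * y, v * z) \<in> I"
          using JI[OF xy] JI[OF yz] by blast
        then have "(v * (u * x), v * (u * y)) \<in> I" "(u * (v * y), u * (v * z)) \<in> I"
          using U_A by (auto intro: mult_left)
        then have "(u * v * x, u * v * z) \<in> I"
          using I.trans by (simp add: mult_ac)
        then show ?thesis
          using J_intro U_mult uv J_A[OF xy] J_A[OF yz] by blast
      qed
      show "(z + x, z + y) \<in> J" if xy: "(x, y) \<in> J" and z: "z \<in> A" for x y z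
      proof -
        obtain u where u: "u \<in> U" "(u * x, u * y) \<in> I"
          using JI[OF xy] by blast
        then show ?thesis
          using add_left[OF u(2), of "u * z"] J_A[OF xy] z U_A
          by (intro J_intro[OF u(1)]) (auto simp: distrib_left)
      qed
      show "(z * x, z * y) \<in> J" if xy: "(x, y) \<in> J" and z: "z \<in> A" for x y z
      proof -
        obtain u where u: "u \<in> U" "(u * x, u * y) \<in> I"
          using JI[OF xy] by blast
        then show ?thesis
          using mult_left[OF u(2), of z] J_A[OF xy] z
          by (intro J_intro[OF u(1)]) (auto simp: mult.left_commute)
      qed
    qed
    moreover have "I \<subseteq> J"
      using IA by (auto intro!: J_intro[OF U_1])
    moreover have "J \<subseteq> A \<times> A"
      by (auto simp: J_def)
    moreover have "(x, y) \<in> J"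
      using J_intro u by blast
    ultimately obtain v where "v \<in> U" "(v * f, v * g) \<in> J"
      using maxD nI by blast
    then obtain v' where "v' \<in> U" "(v' * (v * f), v' * (v * g)) \<in> I"
      using JI by blast
    then show False
      using excl[OF U_mult[OF \<open>v' \<in> U\<close> \<open>v \<in> U\<close>]] by (simp add: mult.assoc)
  qed
  have I_cancel: "(c, 0) \<in> I \<or> (x, y) \<in> I" 
    if c: "x \<in> A" "y \<in> A" "c \<in> A" "(c * x, c * y) \<in> I" for x y c
  proof (rule ccontr)
    assume nI: "\<not> ((c, 0) \<in> I \<or> (x, y) \<in> I)"
    \<comment> \<open>The congruence of pairs that \<open>c\<close> multiplies into
      \<open>I\<close>. Being strictly larger than \<open>I\<close>, it contains a
      \<open>U\<close>-multiple of \<open>(f, g)\<close>, and \<open>U_cancel\<close> removes the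
      multiplier.\<close>
    define J where "J = {(x, y) \<in> A \<times> A. (c * x, c * y) \<in> I}"
    have "cong A J"
    proof (rule cong_by_translations)
      show "(z + x, z + y) \<in> J" if "(x, y) \<in> J" "z \<in> A" for x y z
        using that c add_left[of "c * x" "c * y" "c * z"] by (auto simp: J_def distrib_left)
      show "(z * x, z * y) \<in> J" if "(x, y) \<in> J" "z \<in> A" for x y z
        using that mult_left[of "c * x" "c * y" z] by (auto simp: J_def mult.left_commute)
      show "(x, z) \<in> J" if "(x, y) \<in> J" "(y, z) \<in> J" for x y z
        using that I.trans[of "c * x" "c * y" "c * z"] by (auto simp: J_def)
    qed (use c in \<open>auto simp: J_def intro: I.refl I.sym\<close>)
    then obtain u where u: "u \<in> U" "(c * (u * f), c * (u * g)) \<in> I"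
      using maxD[of J x y] nI c IA mult_left by (force simp: J_def)
    then have "(c * f, c * g) \<in> I"
      using U_cancel[OF u(1), of "c * f" "c * g"] c fg by (simp add: mult.left_commute)
    \<comment> \<open>The congruence generated by \<open>I\<close> and \<open>(c, 0)\<close>, which
      is also strictly larger than \<open>I\<close>.\<close>
    define J' where "J' = {(x, y) \<in> A \<times> A. \<exists>r\<in>A. (x + r * c, y + r * c) \<in> I}"
    have J'_intro: "(x, y) \<in> J'" if "r \<in> A" "(x + r * c, y + r * c) \<in> I" "x \<in> A" "y \<in> A" for r x y
      using that by (auto simp: J'_def)
    have J'_elim: "\<exists>r\<in>A. (x + r * c, y + r * c) \<in> I" "x \<in> A" "y \<in> A" if "(x, y) \<in> J'" for x y
      using that by (auto simp: J'_def)
    have "cong A J'"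
    proof (rule cong_by_translations)
      show "J' \<subseteq> A \<times> A" 
        by (auto simp: J'_def)
      show "(x, x) \<in> J'" if "x \<in> A" for x
        using that c by (auto intro!: J'_intro[of 0] I.refl)
      show "(y, x) \<in> J'" if "(x, y) \<in> J'" for x y
        using J'_elim[OF that] J'_intro I.sym by blast
      show "(x, z) \<in> J'" if xy: "(x, y) \<in> J'" and yz: "(y, z) \<in> J'" for x y z
      proof -
        obtain r r' where r: "r \<in> A" "(x + r * c, y + r * c) \<in> I" 
          "r' \<in> A" "(y + r' * c, z + r' * c) \<in> I"
          using J'_elim(1)[OF xy] J'_elim(1)[OF yz] by blast
        then have "(r' * c + (x + r * c), r' * c + (y + r * c)) \<in> I" 
          "(r * c + (y + r' * c), r * c + (z + r' * c)) \<in> I"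
          using c by (auto intro: add_left)
        then have "(x + (r + r') * c, z + (r + r') * c) \<in> I"
          using I.trans by (simp add: distrib_right add_ac)
        then show ?thesis
          using J'_intro[of "r + r'"] r J'_elim[OF xy] J'_elim[OF yz] by auto
      qed
      show "(z + x, z + y) \<in> J'" if xy: "(x, y) \<in> J'" and z: "z \<in> A" for x y z
      proof -
        obtain r where r: "r \<in> A" "(x + r * c, y + r * c) \<in> I"
          using J'_elim(1)[OF xy] by blast
        then show ?thesis
          using add_left[OF r(2) z] J'_elim(2,3)[OF xy] z
          by (intro J'_intro[OF r(1)]) (auto simp: add.assoc)
      qed
      show "(z * x, z * y) \<in> J'" if xy: "(x, y) \<in> J'" and z: "z \<in> A" for x y z
      proof -
        obtain r where r: "r \<in> A" "(x + r * c, y + r * c) \<in> I"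
          using J'_elim(1)[OF xy] by blast
        then show ?thesis
          using mult_left[OF r(2) z] J'_elim(2,3)[OF xy] z
          by (intro J'_intro[of "z * r"]) (auto simp: distrib_left mult.assoc)
      qed
    qed
    moreover have "I \<subseteq> J'"
      using IA by (auto intro!: J'_intro[of 0])
    moreover have "J' \<subseteq> A \<times> A"
      by (auto simp: J'_def)
    moreover have "(c, 0) \<in> J'"
      using c idem[OF c(3)] by (intro J'_intro[of 1]) (auto intro: I.refl)
    ultimately obtain u where u: "u \<in> U" "(u * f, u * g) \<in> J'"
      using maxD nI by blast
    then obtain r where r: "r \<in> A" "(u * f + r * c, u * g + r * c) \<in> I"
      using J'_elim(1) by blast
    have uA: "u \<in> A"
      using u U_A by blast
    \<comment> \<open>Multiplication by \<open>f\<close> and by \<open>g\<close> relates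
      \<open>(u * s + r * c) * f\<close> to \<open>f * u * g + r * (c * f)\<close> and
      \<open>(u * s + r * c) * g\<close> to \<open>f * u * g + r * (c * g)\<close>. The right sides
      are congruent because \<open>c * f\<close> and \<open>c * g\<close> are, yet
      \<open>u * s + r * c\<close> lies in \<open>U\<close>, which is excluded.\<close>
    have F: "(f * (u * f + r * c), f * (u * g + r * c)) \<in> I"
      and G: "(g * (u * f + r * c), g * (u * g + r * c)) \<in> I"
      using r fg by (auto intro: mult_left)
    have "(f * (u * f + r * c) + f * (u * g + r * c), f * (u * g + r * c) + f * (u * g + r * c)) \<in> I"
      using F uA r(1) fg c by (intro I.add I.refl) auto
    also have "f * (u * f + r * c) + f * (u * g + r * c) = (u * s + r * c) * f"
    proof -
      have "f * (r * c) + (f * (r * c) + (f * (u * f) + f * (u * g))) = 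
          f * (r * c) + (f * (u * f) + f * (u * g))"
        using fg r c by (intro add_idem_left) auto
      then show ?thesis
        by (simp add: s_def distrib_left distrib_right mult_ac add_ac) 
    qed
    also have "f * (u * g + r * c) + f * (u * g + r * c) = f * u * g + r * (c * f)"
      using idem[of "f * (u * g + r * c)"] uA r(1) fg c by (simp add: algebra_simps)
    finally have left: "((u * s + r * c) * f, f * u * g + r * (c * f)) \<in> I" .
    have "(g * (u * f + r * c) + g * (u * f + r * c), g * (u * g + r * c) + g * (u * f + r * c)) \<in> I"
      using G uA r(1) fg c by (intro I.add I.refl) auto
    also have "g * (u * g + r * c) + g * (u * f + r * c) = (u * s + r * c) * g"
    proof -
      have "g * (r * c) + (g * (r * c) + (g * (u * f) + g * (u * g))) = 
          g * (r * c) + (g * (u * f) + g * (u * g))"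
        using fg r c by (intro add_idem_left) auto
      then show ?thesis
        by (simp add: s_def distrib_left distrib_right mult_ac add_ac)
    qed
    also have "g * (u * f + r * c) + g * (u * f + r * c) = f * u * g + r * (c * g)"
      using idem[of "g * (u * f + r * c)"] uA r(1) fg c by (simp add: algebra_simps)
    finally have right: "(f * u * g + r * (c * g), (u * s + r * c) * g) \<in> I" .
    have "(f * u * g + r * (c * f), f * u * g + r * (c * g)) \<in> I"
      using add_left[OF mult_left[OF \<open>(c * f, c * g) \<in> I\<close> r(1)]] uA fg by simp
    then have "((u * s + r * c) * f, (u * s + r * c) * g) \<in> I"
      using left right I.trans by blast
    then show False
      using excl[OF U_add[OF u(1), of "r * c"]] r(1) c by simp
  qed
  interpret I: cancellative_cong A I
  proof
    show "(1, 0) \<notin> I"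
    proof
      assume *: "(1, 0) \<in> I"
      have "(f, 0) \<in> I" "(g, 0) \<in> I"
        using mult_left[OF *] fg by force+
      then have "(f, g) \<in> I"
        using I.trans I.sym by blast
      then show False
        using excl[OF U_1] by simp
    qed
  qed (fact I_cancel)
  have U_nz: "(u, 0) \<notin> I" if "u \<in> U" for u
  proof
    assume *: "(u, 0) \<in> I"
    have "(f * u, 0) \<in> I" "(g * u, 0) \<in> I"
      using I.zero_mult[OF *] fg by auto
    then have "(u * f, u * g) \<in> I"
      using I.trans I.sym by (metis mult.commute)
    then show False
      using excl that by blast
  qed
  have collapse: "\<exists>n. I.le (f * a ^ n) (g * (a + b) ^ n) \<and> I.le (g * a ^ n) (f * (a + b) ^ n)"
    if ab: "a \<in> A" "b \<in> A" "(a + b, a) \<notin> I" for a b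
  proof -
    \<comment> \<open>To identify \<open>a + b\<close> with \<open>a\<close>, this relation lets
      \<open>a\<close> be replaced by \<open>a + b\<close> on the larger side any number of times.
      It is a congruence that contains \<open>I\<close> (with \<open>n = 0\<close>) and
      \<open>(a + b, a)\<close> (with \<open>n = 1\<close>).\<close>
    define J where "J = {(x, y) \<in> A \<times> A. 
      \<exists>n. I.le (x * a ^ n) (y * (a + b) ^ n) \<and> I.le (y * a ^ n) (x * (a + b) ^ n)}"
    have a_le: "I.le a (a + b)" and pA: "a + b \<in> A"
      using ab by (auto intro: I.le_add_left)
    have le_trans_power: "I.le (x * a ^ (n + m)) (z * (a + b) ^ (n + m))"
      if "I.le (x * a ^ n) (y * (a + b) ^ n)" "I.le (y * a ^ m) (z * (a + b) ^ m)" 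
        "x \<in> A" "y \<in> A" "z \<in> A" for x y z n m
    proof -
      have "I.le (a ^ m * (x * a ^ n)) (a ^ m * (y * (a + b) ^ n))"
        "I.le ((a + b) ^ n * (y * a ^ m)) ((a + b) ^ n * (z * (a + b) ^ m))"
        using that ab by (auto intro: I.le_mult_left)
      then show ?thesis
        using I.le_trans[of "a ^ m * (x * a ^ n)" "(a + b) ^ n * (z * (a + b) ^ m)" 
            "a ^ m * (y * (a + b) ^ n)"] that ab by (simp add: power_add mult_ac)
    qed
    have "cong A J"
    proof (rule cong_by_translations)
      show "J \<subseteq> A \<times> A" 
        by (auto simp: J_def)
      show "(x, x) \<in> J" if "x \<in> A" for x
        using that by (auto simp: J_def intro!: exI[of _ 0] I.le_refl)
      show "(y, x) \<in> J" if "(x, y) \<in> J" for x y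
        using that by (auto simp: J_def)
      show "(x, z) \<in> J" if xy: "(x, y) \<in> J" and yz: "(y, z) \<in> J" for x y z
      proof -
        obtain n m where nm: "I.le (x * a ^ n) (y * (a + b) ^ n)" "I.le (y * a ^ n) (x * (a + b) ^ n)"
          "I.le (y * a ^ m) (z * (a + b) ^ m)" "I.le (z * a ^ m) (y * (a + b) ^ m)"
          and A: "x \<in> A" "y \<in> A" "z \<in> A"
          using xy yz by (auto simp: J_def)
        show ?thesis
          using le_trans_power[OF nm(1,3)] le_trans_power[OF nm(4,2)] A 
          by (auto simp: J_def add.commute intro!: exI[of _ "n + m"])
      qed
      show "(z + x, z + y) \<in> J" if xy: "(x, y) \<in> J" and z: "z \<in> A" for x y z
      proof -
        obtain n where n: "I.le (x * a ^ n) (y * (a + b) ^ n)" "I.le (y * a ^ n) (x * (a + b) ^ n)"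
          and A: "x \<in> A" "y \<in> A"
          using xy by (auto simp: J_def)
        have zz: "I.le (z * a ^ n) (z * (a + b) ^ n)"
          using z ab by (intro I.le_mult_left I.le_power_mono a_le) auto
        have mono: "I.le (p + q) (p' + q')" 
          if "I.le p p'" "I.le q q'" "p \<in> A" "q \<in> A" "p' \<in> A" "q' \<in> A" for p q p' q'
          using that I.add[of "p + p'" p' "q + q'" q'] by (simp add: I.le_def add_ac)
        show ?thesis
          using mono[OF zz n(1)] mono[OF zz n(2)] A z ab
          by (auto simp: J_def distrib_right intro!: exI[of _ n])
      qed
      show "(z * x, z * y) \<in> J" if xy: "(x, y) \<in> J" and z: "z \<in> A" for x y z
        using xy z by (auto simp: J_def mult.assoc intro!: I.le_mult_left)
    qed
    moreover have "I \<subseteq> J"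
      using IA I.le_cong I.sym by (fastforce simp: J_def intro!: exI[of _ 0])
    moreover have "J \<subseteq> A \<times> A"
      by (auto simp: J_def)
    moreover have "(a + b, a) \<in> J"
    proof -
      have "I.le ((a + b) * a ^ 1) (a * (a + b) ^ 1)"
        using I.le_refl[of "(a + b) * a"] pA ab(1) by (simp add: mult.commute)
      moreover have "I.le (a * a ^ 1) ((a + b) * (a + b) ^ 1)"
        using I.le_mult_mono[OF ab(1) pA ab(1) pA a_le a_le] by simp
      ultimately show ?thesis
        using ab(1) pA unfolding J_def by blast
    qed
    ultimately obtain u where u: "u \<in> U" "(u * f, u * g) \<in> J"
      using maxD ab(3) by blast
    then obtain n where "I.le (u * (f * a ^ n)) (u * (g * (a + b) ^ n))" 
      "I.le (u * (g * a ^ n)) (u * (f * (a + b) ^ n))"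
      by (auto simp: J_def mult.assoc)
    then show ?thesis
      using U_nz[OF u(1)] U_A[OF u(1)] ab fg by (auto simp: I.le_mult_cancel)
  qed
  interpret I: prime_cong A I
  proof
    show "(a + b, a) \<in> I \<or> (a + b, b) \<in> I" if ab: "a \<in> A" "b \<in> A" for a b
    proof (rule ccontr)
      assume "\<not> ?thesis"
      \<comment> \<open>If both alternatives fail, \<open>collapse\<close> applies to both orders of
        \<open>a\<close> and \<open>b\<close>; the resulting inequalities combine at a power of
        \<open>a + b\<close>, which can be cancelled.\<close>
      then obtain n m where n: "I.le (f * a ^ n) (g * (a + b) ^ n)" "I.le (g * a ^ n) (f * (a + b) ^ n)"
        and m: "I.le (f * b ^ m) (g * (a + b) ^ m)" "I.le (g * b ^ m) (f * (a + b) ^ m)"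
        and ne: "(a + b, a) \<notin> I"
        using collapse[of a b] collapse[of b a] ab by (auto simp: add.commute)
      have "(a + b, 0) \<notin> I"
      proof
        assume *: "(a + b, 0) \<in> I"
        have "I.le a 0"
          using I.le_trans[OF ab(1) zero_mem I.le_add_left[OF ab]] * ab by (simp add: I.le_cong)
        then have "(a + b, a) \<in> I"
          using * I.trans I.sym unfolding I.le_zero_iff by blast
        then show False using ne by blast
      qed
      then have nz: "((a + b) ^ (n + m), 0) \<notin> I"
        using ab by (simp add: I.power_zero_iff)
      have "I.le f g" "I.le g f"
        using I.le_mult_add_power[OF ab fg n(1) m(1)] I.le_mult_add_power[OF ab fg(2,1) n(2) m(2)]
          I.le_mult_cancel[OF _ fg nz] I.le_mult_cancel[OF _ fg(2,1) nz] ab 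
        by (simp_all add: mult.commute)
      then have "(f, g) \<in> I"
        by (rule I.le_antisym)
      then show False
        using excl[OF U_1] by simp
    qed
  qed
  show thesis
    using that[OF I.prime_congI[OF IA] PI] excl[OF U_1] by simp
qed

section \<open>The Nullstellensatz\<close>

lemma tropical_subsemifields:
  assumes "F \<in> {boolean_semifield, zmax_semifield, UNIV}"
  shows "tropical_subsemifield F"
proof -
  have "tropical_subsemifield boolean_semifield"
    by standard (auto simp: boolean_semifield_def tropical_add_eq_max)
  moreover have "tropical_subsemifield zmax_semifield"
  proof
    show "1 \<in> zmax_semifield"
      using image_eqI[of "TPow 0" "\<lambda>c. TPow (of_int c)" 0]
      by (auto simp: zmax_semifield_def one_tropical_def)
    fix a b assume ab: "a \<in> zmax_semifield" "b \<in> zmax_semifield"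
    show "a + b \<in> zmax_semifield"
      using ab by (auto simp: tropical_add_eq_max max_def)
    show "a * b \<in> zmax_semifield"
      using ab by (auto simp: zmax_semifield_def) (metis of_int_add)
  next
    fix a assume "a \<in> zmax_semifield" "a \<noteq> 0"
    then obtain c :: int where "a = TPow (of_int c)"
      by (auto simp: zmax_semifield_def)
    then show "\<exists>b\<in>zmax_semifield. a * b = 1"
      by (intro bexI[of _ "TPow (of_int (- c))"]) 
        (auto simp: zmax_semifield_def one_tropical_def intro!: exI[of _ "- c"])
  qed (simp add: zmax_semifield_def)
  moreover have "tropical_subsemifield UNIV"
  proof
    show "\<exists>b\<in>UNIV. a * b = 1" if "a \<noteq> 0" for a :: tropical
    proof -
      obtain c where "a = TPow c"
        using \<open>a \<noteq> 0\<close> by (rule tropical_neq_0E)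
      then have "a * TPow (- c) = 1"
        by (simp add: one_tropical_def)
      then show ?thesis by blast
    qed
  qed auto
  ultimately show ?thesis
    using assms by auto
qed

lemma formal_sums_over_laurent: 
  assumes "tropical_subsemifield F"
  shows "formal_sums_over F (Poly_Mapping.lookup :: ('n::finite \<Rightarrow>\<^sub>0 int) \<Rightarrow> 'n \<Rightarrow> int)"
proof -
  interpret tropical_subsemifield F by fact
  show ?thesis
    by standard (auto simp: lookup_add fun_eq_iff inj_def poly_mapping_eq_iff)
qed

lemma formal_sums_over_polynomial: 
  assumes "tropical_subsemifield F"
  shows "formal_sums_over F (\<lambda>m :: 'n::finite \<Rightarrow>\<^sub>0 nat. \<lambda>i. int (Poly_Mapping.lookup m i))"
proof -
  interpret tropical_subsemifield F by fact
  show ?thesis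
    by standard (auto simp: lookup_add fun_eq_iff inj_def poly_mapping_eq_iff)
qed

section \<open>The pairs in \<open>E_plus\<close> and the points of the variety\<close>

lemma polynomial_semiring_UNIV: 
  "(polynomial_semiring UNIV :: 'n::finite trop_poly ring) = subsemiring UNIV"
  by (simp add: polynomial_semiring_def formal_sums_eq formal_sum_set_def)

text \<open>A pair \<open>(s, 0)\<close> acts as the scalar \<open>s\<close> under the twisted
  product, so powers of the starred pair and the summand \<open>h\<close> reduce to ordinary
  arithmetic.\<close>

lemma E_plus_iff:
  fixes f g :: "'n::finite trop_poly"
  shows "(f, g) \<in> E_plus E \<longleftrightarrow> (\<exists>\<epsilon> h i. \<epsilon> \<noteq> 1 \<and>
    (((f + g) ^ i + h) * (f + Poly_Mapping.single 0 \<epsilon> * g), 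
     ((f + g) ^ i + h) * (g + Poly_Mapping.single 0 \<epsilon> * f)) \<in> E)"
proof -
  let ?R = "subsemiring UNIV :: 'n trop_poly ring"
  have pow: "twisted_power ?R (s, 0) i = (s ^ i, 0)" for s i
    by (induction i) auto
  have "twisted_prod ?R (twisted_prod ?R (1, e) (pair_add ?R (twisted_power ?R (pair_star ?R (f, g)) i) (h, 0))) (f, g)
     = (((f + g) ^ i + h) * (f + e * g), ((f + g) ^ i + h) * (g + e * f))" for e h i
    by (simp add: pow algebra_simps)
  then show ?thesis
    by (simp add: E_plus_def polynomial_semiring_UNIV Let_def)
qed

text \<open>At a point of the variety
  \<open>u * (F + \<epsilon> * G) = u * (G + \<epsilon> * F)\<close> holds for the values. If
  \<open>u\<close> can be cancelled, \<open>\<epsilon> \<noteq> 1\<close> forces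
  \<open>F = G\<close>, since otherwise the largest term would occur on one side only.\<close>

lemma E_plus_subset_vanishing:
  fixes E :: "('n::finite trop_poly \<times> 'n trop_poly) set"
  shows "E_plus E \<subseteq> vanishing_congruence (trop_variety E)"
proof clarify
  fix f g assume "(f, g) \<in> E_plus E"
  then obtain \<epsilon> h i where \<epsilon>: "\<epsilon> \<noteq> 1" and
    inE: "(((f + g) ^ i + h) * (f + Poly_Mapping.single 0 \<epsilon> * g), 
     ((f + g) ^ i + h) * (g + Poly_Mapping.single 0 \<epsilon> * f)) \<in> E"
    by (auto simp: E_plus_iff)
  have "poly_value f a = poly_value g a" if a: "a \<in> trop_variety E" for a
  proof -
    interpret V: tropical_valuation UNIV "\<lambda>p. poly_value p a"
      by standard (auto simp: poly_mapping_add_idem poly_value_eq_eval_sum poly_value.ev_zero 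
          poly_value.ev_one poly_value.ev_add poly_value.ev_mult)
    define F G u where "F = poly_value f a" and "G = poly_value g a" 
      and "u = (F + G) ^ i + poly_value h a"
    have "poly_value (Poly_Mapping.single 0 \<epsilon>) a = \<epsilon>"
      by (simp add: poly_value_eq_eval_sum poly_value.ev_single monomial_value_def)
    then have eq: "u * (F + \<epsilon> * G) = u * (G + \<epsilon> * F)"
      using a inE by (force simp: trop_variety_def V.v_mult V.v_add V.v_power F_def G_def u_def)
    show ?thesis
    proof (cases "u = 0")
      case True
      \<comment> \<open>For \<open>i = 0\<close> the power is 1 and \<open>u\<close> is nonzero, so
        a vanishing \<open>u\<close> makes \<open>F + G\<close> vanish.\<close>
      then have "F + G = 0"
        by (metis tropical_add_eq_0_iff TPow_power TPow_neq_0 tropical_neq_0E u_def)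
      then show ?thesis
        by (simp add: tropical_add_eq_0_iff F_def G_def)
    next
      case False
      then have "F + \<epsilon> * G = G + \<epsilon> * F"
        using eq by (simp add: tropical_mult_left_cancel)
      then show ?thesis
        using \<epsilon> unfolding F_def[symmetric] G_def[symmetric]
        by (cases F; cases G; cases \<epsilon>) (auto simp: one_tropical_def max_def split: if_splits)
    qed
  qed
  then show "(f, g) \<in> vanishing_congruence (trop_variety E)"
    by (simp add: vanishing_congruence_def)
qed

text \<open>If \<open>(f, g)\<close> were not in \<open>E_plus E\<close>, some prime above
  \<open>E\<close> would miss \<open>(f + e * g, g + e * f)\<close>, and an evaluation that respects
  \<open>E\<close> would separate these entries. With \<open>l = 0\<close> it sends \<open>e\<close>
  to 1 and the entries agree; with \<open>l = 1\<close> it is evaluation at a point of the variety,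
  where \<open>f\<close> and \<open>g\<close> agree.\<close>

lemma vanishing_subset_E_plus:
  fixes E :: "('n::finite trop_poly \<times> 'n trop_poly) set"
  assumes E: "fin_gen_congruence (polynomial_semiring UNIV) E"
  shows "vanishing_congruence (trop_variety E) \<subseteq> E_plus E"
proof clarify
  fix f g assume fg: "(f, g) \<in> vanishing_congruence (trop_variety E)"
  interpret T: formal_sums_over UNIV "\<lambda>m :: 'n \<Rightarrow>\<^sub>0 nat. \<lambda>i. int (Poly_Mapping.lookup m i)"
    by (rule formal_sums_over_polynomial) (simp add: tropical_subsemifields)
  have A: "T.A = UNIV"
    by (simp add: formal_sum_set_def)
  have E': "fin_gen_congruence (subsemiring T.A) E"
    using E by (simp add: A polynomial_semiring_UNIV)
  then interpret E: cong T.A E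
    by (auto simp: fin_gen_congruence_def intro: T.congD)
  \<comment> \<open>Any nonzero constant below 1 would serve: it is absorbed by 1, so the entries of
    the modified pair still add up to \<open>f + g\<close>, the element whose powers occur in
    \<open>E_plus\<close>.\<close>
  define \<epsilon> where "\<epsilon> = TPow (- 1)"
  define e :: "'n trop_poly" where "e = Poly_Mapping.single 0 \<epsilon>"
  have e: "x + e * x = x" for x
  proof -
    have "1 + e = 1"
      by (simp add: e_def \<epsilon>_def one_tropical_def flip: single_add single_one)
    then have "x * (1 + e) = x" by simp
    then show ?thesis by (simp add: algebra_simps)
  qed
  have "(f + e * g) + (g + e * f) = (f + e * f) + (g + e * g)"
    by (simp add: ac_simps)
  then have sum: "(f + e * g) + (g + e * f) = f + g"
    by (simp only: e)
  show "(f, g) \<in> E_plus E"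
  proof (rule ccontr)
    assume nE: "(f, g) \<notin> E_plus E"
    have "\<epsilon> \<noteq> 1"
      by (simp add: \<epsilon>_def one_tropical_def)
    then have "((((f + e * g) + (g + e * f)) ^ i + h) * (f + e * g), 
        (((f + e * g) + (g + e * f)) ^ i + h) * (g + e * f)) \<notin> E" for i h
      using nE unfolding sum unfolding E_plus_iff e_def by blast
    then obtain I where I: "prime_semiring_congruence (subsemiring T.A) I" "E \<subseteq> I" 
      "(f + e * g, g + e * f) \<notin> I"
      using E.prime_excluding[of "f + e * g" "g + e * f"] by (auto simp: A)
    obtain l \<chi> where l: "l \<in> {0, 1}" and me: "monoid_eval (trop_scale l) \<chi>"
      and eq: "\<And>p q. (p, q) \<in> E \<Longrightarrow> eval_sum (trop_scale l) \<chi> p = eval_sum (trop_scale l) \<chi> q"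
      and neq: "eval_sum (trop_scale l) \<chi> (f + e * g) \<noteq> eval_sum (trop_scale l) \<chi> (g + e * f)"
      using T.fin_gen_separation[OF E' I(1,2) _ _ I(3)] by (auto simp: A)
    interpret ev: monoid_eval "trop_scale l" \<chi> by fact
    show False
    proof (cases "l = 0")
      case True
      then have "trop_scale l \<epsilon> = 1"
        by (simp add: \<epsilon>_def one_tropical_def)
      then have "ev.ev e = 1"
        by (simp add: e_def ev.ev_single ev.\<chi>_0)
      then show False
        using neq by (simp add: ev.ev_add ev.ev_mult add.commute)
    next
      case False
      then have "trop_scale l = id"
        using l by (auto simp: fun_eq_iff)
      moreover obtain a where "\<chi> = monomial_value a"
        using multiplicative_eq_monomial_value[OF ev.\<chi>_0 ev.\<chi>_add] by blast
      ultimately have ev: "ev.ev p = poly_value p a" for p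
        by (simp add: poly_value_eq_eval_sum)
      then have "a \<in> trop_variety E"
        using eq by (auto simp: trop_variety_def)
      then have "ev.ev f = ev.ev g"
        using fg by (auto simp: vanishing_congruence_def ev)
      then show False
        using neq by (simp add: ev.ev_add ev.ev_mult)
    qed
  qed
qed

theorem theorem5p4:
  shows
    "(\<forall>F \<in> {boolean_semifield, zmax_semifield, UNIV}.
        (\<forall>E. fin_gen_congruence (laurent_semiring F) E \<longrightarrow>
           congruence_radical (laurent_semiring F :: (('n::finite \<Rightarrow>\<^sub>0 int) \<Rightarrow>\<^sub>0 tropical) ring) E =
           congruence_Inter (laurent_semiring F)
             {P. prime_semiring_congruence (laurent_semiring F) P \<and> E \<subseteq> P \<and>
                 semiring_dim (quotient_semiring (laurent_semiring F) P) \<le> 1}) \<and>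
        (\<forall>E. fin_gen_congruence (polynomial_semiring F) E \<longrightarrow>
           congruence_radical (polynomial_semiring F :: (('n \<Rightarrow>\<^sub>0 nat) \<Rightarrow>\<^sub>0 tropical) ring) E =
           congruence_Inter (polynomial_semiring F)
             {P. prime_semiring_congruence (polynomial_semiring F) P \<and> E \<subseteq> P \<and>
                 semiring_dim (quotient_semiring (polynomial_semiring F) P) \<le> 1})) \<and>
     (\<forall>E :: ('n trop_poly \<times> 'n trop_poly) set.
        fin_gen_congruence (polynomial_semiring UNIV) E \<longrightarrow>
        E_plus E = vanishing_congruence (trop_variety E))"
proof (intro conjI ballI allI impI)
  fix F assume "F \<in> {boolean_semifield, zmax_semifield, UNIV}"
  then have F: "tropical_subsemifield F"
    by (rule tropical_subsemifields)
  show "congruence_radical (laurent_semiring F :: (('n \<Rightarrow>\<^sub>0 int) \<Rightarrow>\<^sub>0 tropical) ring) E =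
      congruence_Inter (laurent_semiring F)
        {P. prime_semiring_congruence (laurent_semiring F) P \<and> E \<subseteq> P \<and>
            semiring_dim (quotient_semiring (laurent_semiring F) P) \<le> 1}"
    if "fin_gen_congruence (laurent_semiring F) E" for E
    using formal_sums_over.radical_eq_dim_le_1[OF formal_sums_over_laurent[OF F]] that
    by (simp add: laurent_semiring_def formal_sums_eq)
  show "congruence_radical (polynomial_semiring F :: (('n \<Rightarrow>\<^sub>0 nat) \<Rightarrow>\<^sub>0 tropical) ring) E =
      congruence_Inter (polynomial_semiring F)
        {P. prime_semiring_congruence (polynomial_semiring F) P \<and> E \<subseteq> P \<and>
            semiring_dim (quotient_semiring (polynomial_semiring F) P) \<le> 1}"
    if "fin_gen_congruence (polynomial_semiring F) E" for E
    using formal_sums_over.radical_eq_dim_le_1[OF formal_sums_over_polynomial[OF F]] that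
    by (simp add: polynomial_semiring_def formal_sums_eq)
next
  fix E :: "('n trop_poly \<times> 'n trop_poly) set"
  assume "fin_gen_congruence (polynomial_semiring UNIV) E"
  then show "E_plus E = vanishing_congruence (trop_variety E)"
    by (intro equalityI E_plus_subset_vanishing vanishing_subset_E_plus)
qed

end
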